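(* Let $k$ be a field and let $m, n, q$ be positive integers. Let $k[X] = k[x_{i,j} : 1\le i\le m,\ 1\le j\le n]$ and let $I_2(X)$ be the ideal generated by the $2\times 2$ minors of the generic matrix $[x_{i,j}]$. Then the length of $$\frac{k[X]}{I_2(X) + (x_{i,j}^q : 1\le i\le m,\ 1\le j\le n) + \sum_{j=1}^{n} (x_{1,j},\ldots,x_{m,j})^q}$$ equals $$N_q(m,n;\overline{\infty};\overline{q-1}) = \sum_{i=1}^{n} (-1)^{n-i}\binom{n}{i}\binom{iq+m-1}{m+n-1},$$ and furthermore this number equals the number of $(m+n-1)$-tuples of non-negative integers that sum up to at most $n(q-1)$ and for which the first $n$ entries are strictly smaller than $q$.
   Context: Length means length as a $k[X]$-module, equivalently dimension as a $k$-vector space. The field $k$ has arbitrary characteristic. A monomial $\prod_{i,j} x_{i,j}^{p_{i,j}}$ (with $1\le i\le m$, $1\le j\le n$, and non-negative integer exponents $p_{i,j}$) is called a staircase monomial if whenever $p_{i,j}>0$ and $i'<i$, $j<j'$, then $p_{i',j'}=0$. For $r_1,\ldots,r_m,c_1,\ldots,c_n\in\{0,1,2,\ldots\}\cup\{\infty\}$, $N_q(m,n;r_1,\ldots,r_m;c_1,\ldots,c_n)$ is the number of staircase monomials $\prod_{i,j} x_{i,j}^{p_{i,j}}$ such that: (i) $\sum_j p_{i,j}\le r_i$ for all $i\in\{1,\ldots,m\}$ and $\sum_i p_{i,j}\le c_j$ for all $j\in\{1,\ldots,n\}$; and (ii) either $\sum_j p_{i,j}<q$ for all $i\in\{1,\ldots,m\}$,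 or $\sum_i p_{i,j}<q$ for all $j\in\{1,\ldots,n\}$. The notation $\overline{c}$ stands for the sequence $c,c,\ldots,c$ of the appropriate length. Binomial coefficients $\binom{a}{b}$ with $0\le a<b$ are $0$. *)

theory Defs
  imports
    "HOL-Library.Poly_Mapping"
    "HOL-Library.Extended_Nat"
    "HOL-Algebra.Algebra"
begin

subsection \<open>Polynomial rings\<close>

text \<open>
  Monomials in variables of type \<^typ>\<open>'v\<close> are finitely supported exponent functions
  \<^typ>\<open>'v \<Rightarrow>\<^sub>0 nat\<close>, and polynomials with coefficients in \<^typ>\<open>'k\<close> are finitely supported
  functions on monomials; the product of the library's type class instance is the usual
  (convolution) product of polynomials.
\<close>

type_synonym ('v, 'k) mpoly = "('v \<Rightarrow>\<^sub>0 nat) \<Rightarrow>\<^sub>0 'k"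

definition Var :: "'v \<Rightarrow> ('v, 'k::field) mpoly"
  where "Var v = Poly_Mapping.single (Poly_Mapping.single v 1) 1"

definition mpoly_ring :: "'v set \<Rightarrow> ('v, 'k::field) mpoly ring"
  where "mpoly_ring V =
    \<lparr>carrier = {f. \<forall>t\<in>Poly_Mapping.keys f. Poly_Mapping.keys t \<subseteq> V},
     monoid.mult = (*), one = 1, ring.zero = 0, add = (+)\<rparr>"

lemma cring_mpoly_ring: "cring (mpoly_ring V :: ('v, 'k::field) mpoly ring)"
proof -
  let ?R = "mpoly_ring V :: ('v, 'k) mpoly ring"
  have ops: "f \<oplus>\<^bsub>?R\<^esub> g = f + g" "f \<otimes>\<^bsub>?R\<^esub> g = f * g" "\<zero>\<^bsub>?R\<^esub> = 0" "\<one>\<^bsub>?R\<^esub> = 1" for f g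
    by (simp_all add: mpoly_ring_def)
  have carr: "f \<in> carrier ?R \<longleftrightarrow> (\<forall>t\<in>Poly_Mapping.keys f. Poly_Mapping.keys t \<subseteq> V)" for f
    by (simp add: mpoly_ring_def)
  have zero: "0 \<in> carrier ?R" and one: "1 \<in> carrier ?R"
    by (simp_all add: carr in_keys_iff lookup_one when_def)
  have add: "f + g \<in> carrier ?R" if "f \<in> carrier ?R" "g \<in> carrier ?R" for f g
    using that Poly_Mapping.keys_add[of f g] unfolding carr by blast
  have uminus: "- f \<in> carrier ?R" if "f \<in> carrier ?R" for f
    using that by (simp add: carr in_keys_iff)
  have mult: "f * g \<in> carrier ?R" if "f \<in> carrier ?R" "g \<in> carrier ?R" for f g
    unfolding carr
  proof
    fix t assume "t \<in> Poly_Mapping.keys (f * g)"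
    then obtain a b where ab: "t = a + b" "a \<in> Poly_Mapping.keys f" "b \<in> Poly_Mapping.keys g"
      using Poly_Mapping.keys_mult[of f g] by blast
    then have "Poly_Mapping.keys a \<subseteq> V" "Poly_Mapping.keys b \<subseteq> V"
      using that unfolding carr by blast+
    then show "Poly_Mapping.keys t \<subseteq> V"
      using Poly_Mapping.keys_add[of a b] unfolding ab(1) by blast
  qed
  show ?thesis
  proof (rule cringI)
    show "abelian_group ?R"
    proof (rule abelian_groupI)
      show "\<exists>g\<in>carrier ?R. g \<oplus>\<^bsub>?R\<^esub> f = \<zero>\<^bsub>?R\<^esub>" if "f \<in> carrier ?R" for f
        using uminus[OF that] by (intro bexI[of _ "- f"]) (simp_all add: ops)
    qed (simp_all add: ops zero add add.assoc add.commute)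
    show "Group.comm_monoid ?R"
      by (rule comm_monoidI) (simp_all add: ops one mult mult.assoc mult.commute)
  qed (simp add: ops distrib_right)
qed


subsection \<open>Quotient modules and length\<close>

definition quot_module :: "('a, 'b) ring_scheme \<Rightarrow> 'a set \<Rightarrow> ('a, 'a set) module"
  where "quot_module R J =
    \<lparr>carrier = carrier (R Quot J),
     monoid.mult = monoid.mult (R Quot J), one = one (R Quot J),
     ring.zero = ring.zero (R Quot J), add = add (R Quot J),
     smult = (\<lambda>a x. (J +>\<^bsub>R\<^esub> a) \<otimes>\<^bsub>R Quot J\<^esub> x)\<rparr>"

lemma module_quot_module:
  assumes "cring R" "ideal J R"
  shows "module R (quot_module R J)"
proof -
  interpret R: cring R by fact
  interpret J: ideal J R by fact
  interpret Q: cring "R Quot J" by (rule J.quotient_is_cring) fact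
  interpret h: ring_hom_ring R "R Quot J" "(+>\<^bsub>R\<^esub>) J" by (rule J.rcos_ring_hom_ring)
  show ?thesis
  proof (rule moduleI)
    show "abelian_group (quot_module R J)"
    proof (rule abelian_groupI)
      show "\<exists>y\<in>carrier (quot_module R J). y \<oplus>\<^bsub>quot_module R J\<^esub> x = \<zero>\<^bsub>quot_module R J\<^esub>"
        if "x \<in> carrier (quot_module R J)" for x
        using that by (intro bexI[of _ "\<ominus>\<^bsub>R Quot J\<^esub> x"]) (simp_all add: quot_module_def Q.l_neg)
    qed (simp_all add: quot_module_def Q.a_ac)
  qed (simp_all add: quot_module_def R.is_cring Q.l_distr Q.r_distr Q.m_assoc)
qed

text \<open>The supremum of the lengths \<open>l\<close> of strict chains \<open>N 0 \<subset> \<dots> \<subset> N l\<close> of submodules.\<close>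

definition module_length :: "('r, 'b) ring_scheme \<Rightarrow> ('r, 'a, 'c) module_scheme \<Rightarrow> enat"
  where "module_length R M =
    Sup {enat l |l. \<exists>N :: nat \<Rightarrow> 'a set.
      (\<forall>i\<le>l. submodule (N i) R M) \<and> (\<forall>i<l. N i \<subset> N (Suc i))}"


subsection \<open>Ideals attached to the generic matrix\<close>

text \<open>The entries of the generic \<open>m \<times> n\<close> matrix are the variables indexed by
  \<open>{1..m} \<times> {1..n}\<close>.\<close>

definition generic_ring :: "nat \<Rightarrow> nat \<Rightarrow> (nat \<times> nat, 'k::field) mpoly ring"
  where "generic_ring m n = mpoly_ring ({1..m} \<times> {1..n})"

definition minors_ideal :: "nat \<Rightarrow> nat \<Rightarrow> (nat \<times> nat, 'k::field) mpoly set"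
  where "minors_ideal m n = Idl\<^bsub>generic_ring m n\<^esub>
    {Var (i, j) * Var (i', j') - Var (i, j') * Var (i', j) |i i' j j'.
       1 \<le> i \<and> i < i' \<and> i' \<le> m \<and> 1 \<le> j \<and> j < j' \<and> j' \<le> n}"

definition var_power_ideal :: "nat \<Rightarrow> nat \<Rightarrow> nat \<Rightarrow> (nat \<times> nat, 'k::field) mpoly set"
  where "var_power_ideal m n q = Idl\<^bsub>generic_ring m n\<^esub>
    {Var (i, j) ^ q |i j. i \<in> {1..m} \<and> j \<in> {1..n}}"

definition column_ideal :: "nat \<Rightarrow> nat \<Rightarrow> nat \<Rightarrow> (nat \<times> nat, 'k::field) mpoly set"
  where "column_ideal m n j = Idl\<^bsub>generic_ring m n\<^esub> {Var (i, j) |i. i \<in> {1..m}}"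

text \<open>Powers and finite sums of ideals are those of the library's semiring of ideals
  \<^const>\<open>ideals_set\<close>.\<close>

definition column_power_ideal :: "nat \<Rightarrow> nat \<Rightarrow> nat \<Rightarrow> (nat \<times> nat, 'k::field) mpoly set"
  where "column_power_ideal m n q =
    (\<Oplus>\<^bsub>ideals_set (generic_ring m n)\<^esub> j\<in>{1..n}.
       column_ideal m n j [^]\<^bsub>ideals_set (generic_ring m n)\<^esub> q)"


subsection \<open>Staircase monomials\<close>

definition staircase :: "nat \<Rightarrow> nat \<Rightarrow> (nat \<times> nat \<Rightarrow>\<^sub>0 nat) \<Rightarrow> bool"
  where "staircase m n p \<longleftrightarrow>
    Poly_Mapping.keys p \<subseteq> {1..m} \<times> {1..n} \<and>
    (\<forall>i\<in>{1..m}. \<forall>j\<in>{1..n}. \<forall>i'\<in>{1..m}. \<forall>j'\<in>{1..n}.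
       Poly_Mapping.lookup p (i, j) > 0 \<and> i' < i \<and> j < j' \<longrightarrow> Poly_Mapping.lookup p (i', j') = 0)"

definition row_sum :: "nat \<Rightarrow> (nat \<times> nat \<Rightarrow>\<^sub>0 nat) \<Rightarrow> nat \<Rightarrow> nat"
  where "row_sum n p i = (\<Sum>j=1..n. Poly_Mapping.lookup p (i, j))"

definition col_sum :: "nat \<Rightarrow> (nat \<times> nat \<Rightarrow>\<^sub>0 nat) \<Rightarrow> nat \<Rightarrow> nat"
  where "col_sum m p j = (\<Sum>i=1..m. Poly_Mapping.lookup p (i, j))"

definition staircase_set ::
  "nat \<Rightarrow> nat \<Rightarrow> nat \<Rightarrow> (nat \<Rightarrow> enat) \<Rightarrow> (nat \<Rightarrow> enat) \<Rightarrow> (nat \<times> nat \<Rightarrow>\<^sub>0 nat) set"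
  where "staircase_set q m n r c =
    {p. staircase m n p \<and>
        (\<forall>i\<in>{1..m}. enat (row_sum n p i) \<le> r i) \<and>
        (\<forall>j\<in>{1..n}. enat (col_sum m p j) \<le> c j) \<and>
        ((\<forall>i\<in>{1..m}. row_sum n p i < q) \<or> (\<forall>j\<in>{1..n}. col_sum m p j < q))}"

definition staircase_number ::
  "nat \<Rightarrow> nat \<Rightarrow> nat \<Rightarrow> (nat \<Rightarrow> enat) \<Rightarrow> (nat \<Rightarrow> enat) \<Rightarrow> nat"
  where "staircase_number q m n r c = card (staircase_set q m n r c)"

lemma finite_staircase_set: "finite (staircase_set q m n r c)"
proof -
  let ?A = "{1..m} \<times> {1..n}"
  let ?F = "{f. \<forall>x. (x \<in> ?A \<longrightarrow> f x \<in> {..q}) \<and> (x \<notin> ?A \<longrightarrow> f x = (0::nat))}"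
  have "Poly_Mapping.lookup ` staircase_set q m n r c \<subseteq> ?F"
  proof clarify
    fix p i j assume p: "p \<in> staircase_set q m n r c"
    have "Poly_Mapping.lookup p (i, j) \<le> q" if ij: "(i, j) \<in> ?A"
    proof -
      have "Poly_Mapping.lookup p (i, j) \<le> row_sum n p i"
        unfolding row_sum_def using ij by (intro member_le_sum) auto
      moreover have "Poly_Mapping.lookup p (i, j) \<le> col_sum m p j"
        unfolding col_sum_def using ij
        by (intro member_le_sum[of i "{1..m}" "\<lambda>i. Poly_Mapping.lookup p (i, j)"]) auto
      moreover have "row_sum n p i < q \<or> col_sum m p j < q"
        using p ij by (auto simp: staircase_set_def)
      ultimately show ?thesis by linarith
    qed
    moreover have "Poly_Mapping.lookup p (i, j) = 0" if "(i, j) \<notin> ?A"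
    proof -
      have "(i, j) \<notin> Poly_Mapping.keys p"
        using p that unfolding staircase_set_def staircase_def by blast
      then show ?thesis by (simp add: in_keys_iff)
    qed
    ultimately show "((i, j) \<in> ?A \<longrightarrow> Poly_Mapping.lookup p (i, j) \<in> {..q}) \<and>
        ((i, j) \<notin> ?A \<longrightarrow> Poly_Mapping.lookup p (i, j) = 0)"
      by simp
  qed
  moreover have "finite ?F" by (rule finite_set_of_finite_funs) auto
  ultimately have "finite (Poly_Mapping.lookup ` staircase_set q m n r c)"
    by (rule finite_subset)
  then show ?thesis by (rule finite_imageD) (auto simp: inj_on_def)
qed

end

theory Submission
  imports Defs "HOL-Library.Product_Plus"
begin

text \<open>
  The map \<open>x\<^sub>i\<^sub>,\<^sub>j \<mapsto> s\<^sub>i t\<^sub>j\<close> sends a monomial to \<open>s\<^sup>r t\<^sup>c\<close>, where \<open>r\<close> and \<open>c\<close> are its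
  row and column sums, and its kernel is \<open>I\<^sub>2\<close>: monomials with equal sums are connected by swaps
  along \<open>2 \<times> 2\<close> minors. A monomial whose \<open>j\<close>-th column sum is at least \<open>q\<close> lies in the \<open>q\<close>-th
  power of the \<open>j\<close>-th column ideal, so the ideal to be divided out consists of the polynomials whose
  image involves only \<open>s\<^sup>r t\<^sup>c\<close> with some \<open>c\<^sub>j \<ge> q\<close>. The quotient therefore has as basis the
  \<open>s\<^sup>r t\<^sup>c\<close> with \<open>\<bar>r\<bar> = \<bar>c\<bar>\<close> and all \<open>c\<^sub>j < q\<close>. Each such pair comes from exactly one staircase
  monomial, found greedily from the top left corner. Replacing \<open>c\<^sub>j\<close> by \<open>q - 1 - c\<^sub>j\<close> and forgetting
  \<open>r\<^sub>m\<close>, which \<open>\<bar>r\<bar> = \<bar>c\<bar>\<close> determines, turns the pairs into the tuples of the theorem, and these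
  are counted by inclusion-exclusion.
\<close>

subsection \<open>Length of a quotient module\<close>

text \<open>Correspondence theorem: preimage and image under the quotient map match submodules of
  the quotient with ideals containing \<open>J\<close>, and both directions preserve strict
  inclusion. The length can then be computed from chains of ideals of \<open>R\<close>
  itself.\<close>

lemma module_length_quot_module:
  assumes "cring R" "ideal J R"
  shows "module_length R (quot_module R J) =
    Sup {enat l |l. \<exists>K :: nat \<Rightarrow> 'a set.
      (\<forall>i\<le>l. ideal (K i) R \<and> J \<subseteq> K i) \<and> (\<forall>i<l. K i \<subset> K (Suc i))}"
proof -
  interpret R: cring R by fact
  interpret J: ideal J R by fact
  interpret Q: cring "R Quot J" by (rule J.quotient_is_cring) fact
  interpret h: ring_hom_ring R "R Quot J" "(+>\<^bsub>R\<^esub>) J" by (rule J.rcos_ring_hom_ring)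
  let ?M = "quot_module R J" and ?pi = "(+>\<^bsub>R\<^esub>) J"
  interpret M: module R ?M by (rule module_quot_module) fact+
  have ops: "carrier ?M = ?pi ` carrier R" "\<zero>\<^bsub>?M\<^esub> = \<zero>\<^bsub>R Quot J\<^esub>"
    "x \<oplus>\<^bsub>?M\<^esub> y = x \<oplus>\<^bsub>R Quot J\<^esub> y" "a \<odot>\<^bsub>?M\<^esub> x = ?pi a \<otimes>\<^bsub>R Quot J\<^esub> x" for a x y
    by (auto simp: quot_module_def FactRing_def A_RCOSETS_def' a_r_coset_def')
  have pi_eq: "?pi a = ?pi b \<Longrightarrow> a \<in> carrier R \<Longrightarrow> b \<in> carrier R \<Longrightarrow> \<exists>j\<in>J. a = j \<oplus>\<^bsub>R\<^esub> b" for a b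
    using J.a_rcos_self[of a] by (auto simp: a_r_coset_def')
  have pi_J: "?pi a = \<zero>\<^bsub>R Quot J\<^esub>" if "a \<in> J" for a
    using that J.a_rcos_const unfolding FactRing_def by simp
  \<comment> \<open>With negation written as multiplication by the scalar -1, closure under negation
    follows from closure under scalars.\<close>
  have neg: "\<ominus>\<^bsub>?M\<^esub> x = (\<ominus>\<^bsub>R\<^esub> \<one>\<^bsub>R\<^esub>) \<odot>\<^bsub>?M\<^esub> x" if "x \<in> carrier ?M" for x
    using that M.smult_l_minus[of "\<one>\<^bsub>R\<^esub>" x] by (metis M.smult_one R.one_closed)
  define pre where "pre N = {a \<in> carrier R. ?pi a \<in> N}" for N
  have pre_ideal: "ideal (pre N) R \<and> J \<subseteq> pre N" if "submodule N R ?M" for N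
  proof -
    note N = M.submoduleE[OF that]
    have smult: "x \<otimes>\<^bsub>R\<^esub> a \<in> pre N" if "a \<in> pre N" "x \<in> carrier R" for a x
      using that N(4)[of x "?pi a"] by (auto simp: pre_def ops h.hom_mult)
    have zero: "\<zero>\<^bsub>R Quot J\<^esub> \<in> N"
      using submodule.axioms(1)[OF that] subgroup.one_closed by (fastforce simp: ops)
    have "subgroup (pre N) (add_monoid R)"
    proof (rule R.add.subgroupI)
      show "pre N \<subseteq> carrier R" by (auto simp: pre_def)
      show "pre N \<noteq> {}" using zero by (auto simp: pre_def intro!: exI[of _ "\<zero>\<^bsub>R\<^esub>"])
      show "\<ominus>\<^bsub>R\<^esub> a \<in> pre N" if "a \<in> pre N" for a
        using smult[OF that, of "\<ominus>\<^bsub>R\<^esub> \<one>\<^bsub>R\<^esub>"] that R.l_minus[of "\<one>\<^bsub>R\<^esub>" a]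
        by (simp add: pre_def)
      show "a \<oplus>\<^bsub>R\<^esub> b \<in> pre N" if "a \<in> pre N" "b \<in> pre N" for a b
        using that N(5)[of "?pi a" "?pi b"] by (auto simp: pre_def ops)
    qed
    then have "ideal (pre N) R"
      using smult by (intro idealI) (auto simp: R.ring_axioms R.m_comm pre_def)
    moreover have "J \<subseteq> pre N"
      using zero J.a_subset by (auto simp: pre_def pi_J)
    ultimately show ?thesis ..
  qed
  have image_submodule: "submodule (?pi ` K) R ?M" if "ideal K R" for K
  proof -
    interpret K: ideal K R by fact
    have smult: "a \<odot>\<^bsub>?M\<^esub> x \<in> ?pi ` K" if a: "a \<in> carrier R" "x \<in> ?pi ` K" for a x
    proof -
      obtain k where k: "k \<in> K" "x = ?pi k" using a by auto
      then have "a \<odot>\<^bsub>?M\<^esub> x = ?pi (a \<otimes>\<^bsub>R\<^esub> k)" using a by (simp add: ops)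
      then show ?thesis using a k K.I_l_closed[of k a] by blast
    qed
    show ?thesis
    proof (rule M.submoduleI)
      show sub: "?pi ` K \<subseteq> carrier ?M" using K.a_subset by (auto simp: ops)
      show "\<zero>\<^bsub>?M\<^esub> \<in> ?pi ` K" using K.zero_closed h.hom_zero unfolding ops by (metis imageI)
      show "\<ominus>\<^bsub>?M\<^esub> x \<in> ?pi ` K" if "x \<in> ?pi ` K" for x
        using smult[of "\<ominus>\<^bsub>R\<^esub> \<one>\<^bsub>R\<^esub>" x] that sub by (auto simp: neg)
      show "x \<oplus>\<^bsub>?M\<^esub> y \<in> ?pi ` K" if xy: "x \<in> ?pi ` K" "y \<in> ?pi ` K" for x y
      proof -
        obtain a b where ab: "a \<in> K" "x = ?pi a" "b \<in> K" "y = ?pi b" using xy by auto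
        then have "x \<oplus>\<^bsub>?M\<^esub> y = ?pi (a \<oplus>\<^bsub>R\<^esub> b)" by (simp add: ops)
        then show ?thesis using ab K.a_closed[of a b] by blast
      qed
    qed (rule smult)
  qed
  have "(\<exists>N. (\<forall>i\<le>l. submodule (N i) R ?M) \<and> (\<forall>i<l. N i \<subset> N (Suc i))) \<longleftrightarrow>
    (\<exists>K. (\<forall>i\<le>l. ideal (K i) R \<and> J \<subseteq> K i) \<and> (\<forall>i<l. K i \<subset> K (Suc i)))" for l
  proof
    assume "\<exists>N. (\<forall>i\<le>l. submodule (N i) R ?M) \<and> (\<forall>i<l. N i \<subset> N (Suc i))"
    then obtain N where N: "\<And>i. i \<le> l \<Longrightarrow> submodule (N i) R ?M" "\<And>i. i < l \<Longrightarrow> N i \<subset> N (Suc i)"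
      by auto
    have "pre (N i) \<subset> pre (N (Suc i))" if i: "i < l" for i
    proof -
      obtain x where x: "x \<in> N (Suc i)" "x \<notin> N i" using N(2)[OF i] by auto
      have "x \<in> carrier ?M" using M.submoduleE(1)[OF N(1)[of "Suc i"]] i x by auto
      then obtain a where "a \<in> carrier R" "x = ?pi a" by (auto simp: ops)
      then have "a \<in> pre (N (Suc i)) - pre (N i)" using x by (auto simp: pre_def)
      then show ?thesis using N(2)[OF i] by (auto simp: pre_def)
    qed
    then show "\<exists>K. (\<forall>i\<le>l. ideal (K i) R \<and> J \<subseteq> K i) \<and> (\<forall>i<l. K i \<subset> K (Suc i))"
      using pre_ideal N(1) by (intro exI[of _ "\<lambda>i. pre (N i)"]) auto
  next
    assume "\<exists>K. (\<forall>i\<le>l. ideal (K i) R \<and> J \<subseteq> K i) \<and> (\<forall>i<l. K i \<subset> K (Suc i))"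
    then obtain K where K: "\<And>i. i \<le> l \<Longrightarrow> ideal (K i) R" "\<And>i. i \<le> l \<Longrightarrow> J \<subseteq> K i"
      "\<And>i. i < l \<Longrightarrow> K i \<subset> K (Suc i)"
      by auto
    have "?pi ` K i \<subset> ?pi ` K (Suc i)" if i: "i < l" for i
    proof -
      interpret K: ideal "K i" R using K i by auto
      interpret K': ideal "K (Suc i)" R using K i by auto
      obtain a where a: "a \<in> K (Suc i)" "a \<notin> K i" using K(3)[OF i] by auto
      \<comment> \<open>Elements with the same coset differ by an element of \<open>J\<close>, and
        \<open>J\<close> lies in \<open>K i\<close>; so \<open>a\<close> cannot collide with an
        element of \<open>K i\<close>.\<close>
      have "?pi a \<notin> ?pi ` K i"
      proof
        assume "?pi a \<in> ?pi ` K i"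
        then obtain b where b: "b \<in> K i" "?pi a = ?pi b" by auto
        then obtain j where "j \<in> J" "a = j \<oplus>\<^bsub>R\<^esub> b" using pi_eq[of a b] a by auto
        then show False using a b K(2)[of i] i by auto
      qed
      then show ?thesis using K(3)[OF i] a by auto
    qed
    then show "\<exists>N. (\<forall>i\<le>l. submodule (N i) R ?M) \<and> (\<forall>i<l. N i \<subset> N (Suc i))"
      using image_submodule K(1) by (intro exI[of _ "\<lambda>i. ?pi ` K i"]) auto
  qed
  then show ?thesis by (simp add: module_length_def)
qed

subsection \<open>Pushing forward finitely supported functions\<close>

text \<open>The step is phrased as a sum, so that additive maps such as \<open>push\<close> can be
  pulled through it directly.\<close>

lemma poly_mapping_induct_keys [consumes 1, case_names zero add]:
  fixes f :: "'a \<Rightarrow>\<^sub>0 'c::comm_monoid_add"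
  assumes "Poly_Mapping.keys f \<subseteq> A"
    and "P 0"
    and "\<And>a c g. a \<in> A \<Longrightarrow> Poly_Mapping.keys g \<subseteq> A \<Longrightarrow> P g \<Longrightarrow> P (Poly_Mapping.single a c + g)"
  shows "P f"
  using assms(1)
proof (induction f rule: update_induct)
  case (update f a b)
  then have "Poly_Mapping.keys f \<subseteq> A" "a \<in> A" by (auto simp: keys_update)
  moreover have "Poly_Mapping.update a b f = Poly_Mapping.single a b + f"
    using update(1) by (intro poly_mapping_eqI)
      (auto simp: lookup_update lookup_add lookup_single when_def in_keys_iff)
  ultimately show ?case using update.IH assms(3) by simp
qed (rule assms(2))

text \<open>Used on two levels: on exponent vectors it adds up exponents along the fibres of
  \<open>h\<close>, giving row and column sums; on polynomials it is the linear extension of a map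
  between monomials.\<close>

definition push :: "('a \<Rightarrow> 'b) \<Rightarrow> ('a \<Rightarrow>\<^sub>0 'c) \<Rightarrow> 'b \<Rightarrow>\<^sub>0 'c::comm_monoid_add"
  where "push h f = (\<Sum>x\<in>Poly_Mapping.keys f. Poly_Mapping.single (h x) (Poly_Mapping.lookup f x))"

lemma push_superset:
  assumes "finite A" "Poly_Mapping.keys f \<subseteq> A"
  shows "push h f = (\<Sum>x\<in>A. Poly_Mapping.single (h x) (Poly_Mapping.lookup f x))"
  unfolding push_def by (rule sum.mono_neutral_left) (use assms in \<open>auto simp: in_keys_iff\<close>)

lemma lookup_push:
  assumes "finite A" "Poly_Mapping.keys f \<subseteq> A"
  shows "Poly_Mapping.lookup (push h f) b = (\<Sum>x\<in>A. Poly_Mapping.lookup f x when h x = b)"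
  by (simp add: push_superset[OF assms] lookup_sum lookup_single)

lemma push_zero [simp]: "push h 0 = 0"
  by (simp add: push_def)

lemma push_single [simp]: "push h (Poly_Mapping.single x c) = Poly_Mapping.single (h x) c"
  by (simp add: push_def)

lemma push_add: "push h (f + g) = push h f + push h g"
proof -
  let ?A = "Poly_Mapping.keys f \<union> Poly_Mapping.keys g"
  have "push h (f + g) = (\<Sum>x\<in>?A. Poly_Mapping.single (h x) (Poly_Mapping.lookup (f + g) x))"
    using Poly_Mapping.keys_add[of f g] by (intro push_superset) auto
  also have "\<dots> = push h f + push h g"
    by (simp add: push_superset[of ?A] lookup_add single_add sum.distrib)
  finally show ?thesis .
qed

lemma push_uminus: "push h (- f) = - push h f" for f :: "'a \<Rightarrow>\<^sub>0 'c::ab_group_add"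
  using push_add[of h f "- f"] by (simp add: eq_neg_iff_add_eq_0 add.commute)

lemma push_diff: "push h (f - g) = push h f - push h g" for f g :: "'a \<Rightarrow>\<^sub>0 'c::ab_group_add"
  using push_add[of h f "- g"] by (simp add: push_uminus)

text \<open>The linear extension of a monoid homomorphism is multiplicative: both sides are additive
  in each factor, so comparing them on single terms suffices.\<close>

lemma push_mult:
  fixes h :: "'a::monoid_add \<Rightarrow> 'b::monoid_add" and f g :: "'a \<Rightarrow>\<^sub>0 'c::semiring_0"
  assumes "\<And>x y. h (x + y) = h x + h y"
  shows "push h (f * g) = push h f * push h g"
proof -
  have single: "push h (Poly_Mapping.single a c * g) = Poly_Mapping.single (h a) c * push h g" for a c
    using subset_UNIV
    by (induction g rule: poly_mapping_induct_keys)
      (simp_all add: distrib_left push_add mult_single assms)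
  show ?thesis
    using subset_UNIV
    by (induction f rule: poly_mapping_induct_keys)
      (simp_all add: distrib_right push_add single)
qed

lemma push_push: "push h (push h' f) = push (\<lambda>x. h (h' x)) f"
  using subset_UNIV by (induction f rule: poly_mapping_induct_keys) (simp_all add: push_add)

lemma keys_push_subset: "Poly_Mapping.keys (push h f) \<subseteq> h ` Poly_Mapping.keys f"
  unfolding push_def by (rule order_trans[OF Poly_Mapping.keys_sum]) auto

text \<open>Natural number coefficients cannot cancel, so the general inclusion becomes an
  equality.\<close>

lemma keys_push: "Poly_Mapping.keys (push h f) = h ` Poly_Mapping.keys f" for f :: "'a \<Rightarrow>\<^sub>0 nat"
proof (rule antisym[OF keys_push_subset], clarify)
  fix x assume "x \<in> Poly_Mapping.keys f"
  then show "h x \<in> Poly_Mapping.keys (push h f)"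
    by (auto simp: in_keys_iff lookup_push[of "Poly_Mapping.keys f"] when_def)
qed

text \<open>The degree of a monomial. As a pushforward to a single point, it inherits additivity and
  invariance under \<open>push\<close> from \<open>push_add\<close> and
  \<open>push_push\<close>.\<close>

definition total :: "('a \<Rightarrow>\<^sub>0 nat) \<Rightarrow> nat"
  where "total f = Poly_Mapping.lookup (push (\<lambda>_. ()) f) ()"

lemma total_eq_sum: "finite A \<Longrightarrow> Poly_Mapping.keys f \<subseteq> A \<Longrightarrow> total f = (\<Sum>x\<in>A. Poly_Mapping.lookup f x)"
  by (simp add: total_def lookup_push)

lemma total_add: "total (f + g) = total f + total g"
  by (simp add: total_def push_add lookup_add)

lemma total_zero [simp]: "total 0 = 0"
  by (simp add: total_def)

lemma total_single [simp]: "total (Poly_Mapping.single x c) = c"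
  by (simp add: total_def)

lemma total_push [simp]: "total (push h f) = total f"
  by (simp add: total_def push_push)

lemma total_eq_0_iff [simp]: "total f = 0 \<longleftrightarrow> f = 0"
  by (subst total_eq_sum[of "Poly_Mapping.keys f"]) (auto simp: in_keys_iff intro: poly_mapping_eqI)

lemma keys_add_nat [simp]:
  "Poly_Mapping.keys (f + g) = Poly_Mapping.keys f \<union> Poly_Mapping.keys g" for f g :: "'a \<Rightarrow>\<^sub>0 nat"
  by (auto simp: in_keys_iff lookup_add)

text \<open>Splits one variable off a monomial; this drives the inductions on degree below.\<close>

lemma in_keys_decompose:
  fixes f :: "'a \<Rightarrow>\<^sub>0 nat"
  assumes "x \<in> Poly_Mapping.keys f"
  obtains g where "f = Poly_Mapping.single x 1 + g"
proof
  show "f = Poly_Mapping.single x 1 + (f - Poly_Mapping.single x 1)"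
    using assms by (intro poly_mapping_eqI)
      (auto simp: lookup_add lookup_minus lookup_single when_def in_keys_iff)
qed

text \<open>The pair of exponent vectors of the image of the monomial \<open>t\<close> under
  \<open>x\<^sub>i\<^sub>,\<^sub>j \<mapsto> s\<^sub>i t\<^sub>j\<close>; pushing a polynomial forward along it computes that ring homomorphism.\<close>

definition weight :: "('a \<times> 'b \<Rightarrow>\<^sub>0 nat) \<Rightarrow> ('a \<Rightarrow>\<^sub>0 nat) \<times> ('b \<Rightarrow>\<^sub>0 nat)"
  where "weight t = (push fst t, push snd t)"

lemma weight_add: "weight (s + t) = weight s + weight t"
  by (simp add: weight_def push_add)

lemma weight_zero [simp]: "weight 0 = 0"
  by (simp add: weight_def zero_prod_def)

lemma weight_single [simp]:
  "weight (Poly_Mapping.single x c) = (Poly_Mapping.single (fst x) c, Poly_Mapping.single (snd x) c)"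
  by (simp add: weight_def)

lemma total_fst_weight [simp]: "total (fst (weight t)) = total t"
  and total_snd_weight [simp]: "total (snd (weight t)) = total t"
  by (simp_all add: weight_def)

lemma lookup_snd_weight:
  assumes "Poly_Mapping.keys t \<subseteq> {1..m} \<times> {1..n}"
  shows "Poly_Mapping.lookup (snd (weight t)) j = col_sum m t j"
proof -
  \<comment> \<open>\<open>j\<close> may lie outside \<open>{1..n}\<close>; inserting it into the
    index set makes the sum over columns pick out \<open>b = j\<close> in every case.\<close>
  have "Poly_Mapping.lookup (snd (weight t)) j =
      (\<Sum>x\<in>{1..m} \<times> insert j {1..n}. Poly_Mapping.lookup t x when snd x = j)"
    using assms by (simp add: weight_def) (rule lookup_push, auto)
  also have "\<dots> = (\<Sum>a=1..m. \<Sum>b\<in>insert j {1..n}. Poly_Mapping.lookup t (a, b) when b = j)"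
    by (simp add: sum.cartesian_product split_beta)
  also have "\<dots> = (\<Sum>a=1..m. Poly_Mapping.lookup t (a, j))"
    by (simp add: when_def)
  finally show ?thesis by (simp add: col_sum_def)
qed

lemma keys_weight:
  "Poly_Mapping.keys t \<subseteq> A \<times> B \<longleftrightarrow>
    Poly_Mapping.keys (fst (weight t)) \<subseteq> A \<and> Poly_Mapping.keys (snd (weight t)) \<subseteq> B"
  by (force simp: weight_def keys_push)

subsection \<open>Counting tuples\<close>

text \<open>Bounding only the first \<open>k\<close> entries allows the bounds to be imposed one at
  a time.\<close>

definition bounded_tuples :: "nat \<Rightarrow> nat \<Rightarrow> nat \<Rightarrow> nat \<Rightarrow> nat list set"
  where "bounded_tuples q k d L = {t. length t = d \<and> sum_list t \<le> L \<and> (\<forall>i<k. t ! i < q)}"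

lemma finite_bounded_tuples: "finite (bounded_tuples q k d L)"
proof (rule finite_subset)
  show "bounded_tuples q k d L \<subseteq> {t. set t \<subseteq> {..L} \<and> length t = d}"
    using member_le_sum_list by (fastforce simp: bounded_tuples_def)
qed (rule finite_lists_length_eq, simp)

text \<open>Stars and bars: the slack \<open>L - sum_list t\<close>, put in front, turns the
  inequality into an equation for \<open>d + 1\<close> entries.\<close>

lemma card_bounded_tuples_0: "card (bounded_tuples q 0 d L) = (L + d) choose d"
proof -
  have "bij_betw (\<lambda>t. (L - sum_list t) # t) (bounded_tuples q 0 d L)
      {l. length l = Suc d \<and> sum_list l = L}"
    by (rule bij_betw_byWitness[where f' = tl])
      (auto simp: bounded_tuples_def length_Suc_conv)
  then have "card (bounded_tuples q 0 d L) = card {l. length l = Suc d \<and> sum_list l = L}"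
    by (rule bij_betw_same_card)
  also have "\<dots> = (L + d) choose L"
    by (simp only: card_length_sum_list) simp
  also have "\<dots> = (L + d) choose d"
    by (subst binomial_symmetric) auto
  finally show ?thesis .
qed

text \<open>One step of inclusion-exclusion: the tuples that violate the new bound at position
  \<open>k\<close> become, after subtracting \<open>q\<close> from that entry, the tuples with sum
  at most \<open>L - q\<close> and bounds only on the first \<open>k\<close> entries.\<close>

lemma card_bounded_tuples_Suc:
  assumes "k < d"
  shows "card (bounded_tuples q k d L) =
    card (bounded_tuples q (Suc k) d L) + (if q \<le> L then card (bounded_tuples q k d (L - q)) else 0)"
proof -
  let ?T = "bounded_tuples q k d L"
  let ?S = "{t \<in> ?T. q \<le> t ! k}"
  have entry_le: "t ! k \<le> sum_list t" if "length t = d" for t :: "nat list"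
    using that assms elem_le_sum_list[of k t] by simp
  have "?T = bounded_tuples q (Suc k) d L \<union> ?S"
    by (auto simp: bounded_tuples_def less_Suc_eq)
  moreover have "bounded_tuples q (Suc k) d L \<inter> ?S = {}"
    by (auto simp: bounded_tuples_def)
  ultimately have "card ?T = card (bounded_tuples q (Suc k) d L) + card ?S"
    using finite_bounded_tuples[of q k d L] finite_bounded_tuples[of q "Suc k" d L]
    by (metis (no_types, lifting) card_Un_disjoint finite_Un)
  moreover have "card ?S = (if q \<le> L then card (bounded_tuples q k d (L - q)) else 0)"
  proof (cases "q \<le> L")
    case True
    have "bij_betw (\<lambda>t. t[k := t ! k - q]) ?S (bounded_tuples q k d (L - q))"
    proof (rule bij_betw_byWitness[where f' = "\<lambda>t. t[k := t ! k + q]"])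
      show "(\<lambda>t. t[k := t ! k - q]) ` ?S \<subseteq> bounded_tuples q k d (L - q)"
        using assms entry_le by (auto simp: bounded_tuples_def sum_list_update)
      show "(\<lambda>t. t[k := t ! k + q]) ` bounded_tuples q k d (L - q) \<subseteq> ?S"
        using assms entry_le True by (auto simp: bounded_tuples_def sum_list_update)
    qed (use assms in \<open>auto simp: bounded_tuples_def\<close>)
    then show ?thesis using True by (simp add: bij_betw_same_card)
  next
    case False
    then have "?S = {}" using entry_le by (fastforce simp: bounded_tuples_def)
    then show ?thesis using False by (metis card.empty)
  qed
  ultimately show ?thesis by simp
qed

text \<open>The bound on the sum ranges over the integers so that the recursion in \<open>k\<close>
  also covers the case where the bound becomes negative.\<close>

lemma card_bounded_tuples_int:
  fixes L :: int
  assumes "k \<le> d"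
  shows "(if 0 \<le> L then int (card (bounded_tuples q k d (nat L))) else 0) =
    (\<Sum>i\<le>k. (-1) ^ i * int (k choose i) *
      (if int (i * q) \<le> L then int ((nat (L - int (i * q)) + d) choose d) else 0))"
  using assms
proof (induction k arbitrary: L)
  case 0
  then show ?case by (simp add: card_bounded_tuples_0)
next
  case (Suc k)
  define C where "C k L = (if 0 \<le> L then int (card (bounded_tuples q k d (nat L))) else 0)" for k and L :: int
  define G where "G L = (if 0 \<le> L then int ((nat L + d) choose d) else 0)" for L :: int
  have IH: "C k L = (\<Sum>i\<le>k. (-1) ^ i * int (k choose i) * G (L - int (i * q)))" for L
    using Suc.IH[of L] Suc.prems by (simp add: C_def G_def del: of_nat_mult)
  have nat_diff: "nat (L - int q) = nat L - q" by linarith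
  have "C k L = C (Suc k) L + C k (L - int q)"
    using card_bounded_tuples_Suc[of k d q "nat L"] Suc.prems
    by (auto simp: C_def nat_diff nat_le_iff le_nat_iff)
  then have "C (Suc k) L = C k L - C k (L - int q)" by simp
  \<comment> \<open>The first sum gains the term \<open>i = Suc k\<close>, which is 0 because
    \<open>k choose Suc k\<close> is. This prepares the index shift, after which Pascal's rule
    merges the two sums.\<close>
  also have "\<dots> = (\<Sum>i\<le>Suc k. (-1) ^ i * int (k choose i) * G (L - int (i * q)))
      - (\<Sum>i\<le>k. (-1) ^ i * int (k choose i) * G (L - int (Suc i * q)))"
    by (simp add: IH algebra_simps)
  also have "\<dots> = (\<Sum>i\<le>Suc k. (-1) ^ i * int (Suc k choose i) * G (L - int (i * q)))"
    unfolding sum.atMost_Suc_shift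
    by (simp add: sum_subtractf[symmetric] sum.distrib[symmetric] sum_negf[symmetric] algebra_simps)
  finally show ?case by (simp add: C_def G_def del: of_nat_mult sum.atMost_Suc)
qed

text \<open>Inclusion-exclusion with all \<open>n\<close> bounds imposed,
  \<open>L = n * (q - 1)\<close> and \<open>d = m + n - 1\<close>. The tops of the binomials
  simplify to \<open>(n - i) * q + m - 1\<close>, and replacing \<open>i\<close> by
  \<open>n - i\<close> gives the stated sum.\<close>

lemma card_bounded_tuples_formula:
  assumes "m > 0" "n > 0" "q > 0"
  shows "int (card (bounded_tuples q n (m + n - 1) (n * (q - 1)))) =
    (\<Sum>i=1..n. (-1) ^ (n - i) * int (n choose i) * int ((i * q + m - 1) choose (m + n - 1)))"
proof -
  let ?d = "m + n - 1"
  let ?f = "\<lambda>i. (-1) ^ (n - i) * int (n choose i) * int ((i * q + m - 1) choose ?d)"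
  have summand: "(if int (i * q) \<le> int (n * (q - 1))
      then int ((nat (int (n * (q - 1)) - int (i * q)) + ?d) choose ?d) else 0) =
      int (((n - i) * q + m - 1) choose ?d)" if "i \<le> n" for i
  proof -
    have eq: "n * (q - 1) + n = (n - i) * q + i * q"
    proof -
      have "n * (q - 1) + n = n * q" using assms by (cases q) auto
      also have "\<dots> = (n - i) * q + i * q" using that by (simp flip: add_mult_distrib)
      finally show ?thesis .
    qed
    show ?thesis
    proof (cases "i * q \<le> n * (q - 1)")
      case True
      then have "nat (int (n * (q - 1)) - int (i * q)) + ?d = (n - i) * q + m - 1"
        using eq assms by linarith
      then show ?thesis using True by (simp only: of_nat_le_iff if_True)
    next
      case False
      then have "(n - i) * q + m - 1 < ?d"
        using eq assms by linarith
      then show ?thesis using False by (simp only: of_nat_le_iff if_False binomial_eq_0 of_nat_0)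
    qed
  qed
  have "int (card (bounded_tuples q n ?d (n * (q - 1)))) =
      (\<Sum>i\<le>n. (-1) ^ i * int (n choose i) * int (((n - i) * q + m - 1) choose ?d))"
    using card_bounded_tuples_int[of n ?d "int (n * (q - 1))" q] assms summand
    by (simp del: of_nat_mult)
  also have "\<dots> = (\<Sum>i\<le>n. ?f i)"
    by (rule sum.reindex_bij_witness[where i = "\<lambda>i. n - i" and j = "\<lambda>i. n - i"])
      (auto simp: binomial_symmetric[symmetric])
  also have "\<dots> = (\<Sum>i=1..n. ?f i)"
  proof -
    have "?f 0 = 0" using assms by (simp add: binomial_eq_0)
    moreover have "{..n} = insert 0 {1..n}" by auto
    ultimately show ?thesis by simp
  qed
  finally show ?thesis .
qed

subsection \<open>Staircase monomials and their row and column sums\<close>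

lemma lookup_eq_0_outside: "Poly_Mapping.keys f \<subseteq> A \<Longrightarrow> x \<notin> A \<Longrightarrow> Poly_Mapping.lookup f x = 0"
  by (auto simp: in_keys_iff)

text \<open>In terms of the support: it is a chain for the componentwise order.\<close>

lemma staircase_iff:
  "staircase m n t \<longleftrightarrow> Poly_Mapping.keys t \<subseteq> {1..m} \<times> {1..n} \<and>
    (\<forall>x\<in>Poly_Mapping.keys t. \<forall>y\<in>Poly_Mapping.keys t. fst y < fst x \<longrightarrow> snd y \<le> snd x)"
  (is "?L \<longleftrightarrow> ?R")
proof
  assume ?L
  show ?R
  proof (intro conjI ballI impI)
    show keys: "Poly_Mapping.keys t \<subseteq> {1..m} \<times> {1..n}" using \<open>?L\<close> by (simp add: staircase_def)
    fix x y assume xy: "x \<in> Poly_Mapping.keys t" "y \<in> Poly_Mapping.keys t" "fst y < fst x"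
    obtain i j i' j' where eq: "x = (i, j)" "y = (i', j')" by (cases x, cases y)
    have "i \<in> {1..m}" "j \<in> {1..n}" "i' \<in> {1..m}" "j' \<in> {1..n}"
      using xy keys unfolding eq by blast+
    then have "\<not> j < j'"
      using \<open>?L\<close> xy unfolding staircase_def eq in_keys_iff by (metis fst_conv neq0_conv)
    then show "snd y \<le> snd x" by (simp add: eq)
  qed
next
  assume R: ?R
  have "Poly_Mapping.lookup t (i', j') = 0"
    if "Poly_Mapping.lookup t (i, j) > 0" "i' < i" "j < j'" for i j i' j'
  proof (rule ccontr)
    assume "Poly_Mapping.lookup t (i', j') \<noteq> 0"
    then have "(i', j') \<in> Poly_Mapping.keys t" "(i, j) \<in> Poly_Mapping.keys t"
      using that by (auto simp: in_keys_iff)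
    then show False using R that by force
  qed
  then show ?L using R by (auto simp: staircase_def)
qed

lemma staircase_add_left:
  assumes "staircase m n (s + t)"
  shows "staircase m n t"
  using assms by (simp add: staircase_iff)

text \<open>Let \<open>i\<close> and \<open>j\<close> be the least row and column met by the
  support, say at \<open>(i, b)\<close> and \<open>(a, j)\<close>. If \<open>i < a\<close>, the
  staircase condition forces \<open>b = j\<close>; otherwise \<open>a = i\<close>. The position of
  this corner is read off from the weight alone.\<close>

lemma staircase_corner:
  assumes "staircase m n t" "t \<noteq> 0"
  shows "(Min (Poly_Mapping.keys (fst (weight t))), Min (Poly_Mapping.keys (snd (weight t))))
    \<in> Poly_Mapping.keys t"
proof -
  let ?K = "Poly_Mapping.keys t"
  define i where "i = Min (fst ` ?K)"
  define j where "j = Min (snd ` ?K)"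
  have ne: "?K \<noteq> {}" using assms by (auto simp: in_keys_iff intro!: poly_mapping_eqI)
  then have "i \<in> fst ` ?K" "j \<in> snd ` ?K"
    unfolding i_def j_def by (auto intro!: Min_in)
  then obtain b a where ab: "(i, b) \<in> ?K" "(a, j) \<in> ?K" by force
  have le: "i \<le> a" "j \<le> b"
    using ab unfolding i_def j_def by (auto intro!: Min_le intro: rev_image_eqI)
  have "i < a \<longrightarrow> b \<le> j"
    using assms(1) ab by (fastforce simp: staircase_iff)
  then have "(i, j) \<in> ?K" using ab le by (cases "i = a") auto
  then show ?thesis by (simp add: i_def j_def weight_def keys_push)
qed

text \<open>Equal weights give the same corner in both monomials; removing it lowers the degree and
  keeps both staircase.\<close>

lemma staircase_weight_inj:
  assumes "staircase m n s" "staircase m n t" "weight s = weight t"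
  shows "s = t"
  using assms
proof (induction "total s" arbitrary: s t)
  case 0
  then have "total t = 0" by (metis total_fst_weight)
  then show ?case using 0 by simp
next
  case (Suc d)
  let ?x = "(Min (Poly_Mapping.keys (fst (weight t))), Min (Poly_Mapping.keys (snd (weight t))))"
  have "total t = Suc d" using Suc by (metis total_fst_weight)
  then have "s \<noteq> 0" "t \<noteq> 0" using Suc.hyps by auto
  then have "?x \<in> Poly_Mapping.keys s" "?x \<in> Poly_Mapping.keys t"
    using staircase_corner[of m n s] staircase_corner[of m n t] Suc.prems by simp_all
  then obtain s' t' where eq: "s = Poly_Mapping.single ?x 1 + s'" "t = Poly_Mapping.single ?x 1 + t'"
    by (metis in_keys_decompose)
  have "s' = t'"
  proof (rule Suc.hyps(1))
    show "d = total s'" using Suc.hyps(2) by (subst (asm) eq(1)) (simp add: total_add)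
    show "staircase m n s'" "staircase m n t'" using Suc.prems eq staircase_add_left by metis+
    have "weight (Poly_Mapping.single ?x 1) + weight s' = weight (Poly_Mapping.single ?x 1) + weight t'"
      using Suc.prems(3) eq weight_add by metis
    then show "weight s' = weight t'" by simp
  qed
  then show ?case using eq by simp
qed

text \<open>The greedy construction: take one unit from the least row and the least column still
  present, solve the smaller problem, and put the unit back as the corner.\<close>

lemma staircase_weight_surj:
  assumes "total r = total c" "Poly_Mapping.keys r \<subseteq> {1..m}" "Poly_Mapping.keys c \<subseteq> {1..n}"
  obtains t where "staircase m n t" "weight t = (r, c)"
proof -
  have "\<exists>t. staircase m n t \<and> weight t = (r, c)"
    using assms
  proof (induction "total r" arbitrary: r c)
    case 0
    then have "r = 0" "c = 0" by (metis total_eq_0_iff)+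
    then show ?case by (intro exI[of _ 0]) (simp add: staircase_iff zero_prod_def)
  next
    case (Suc d)
    define i where "i = Min (Poly_Mapping.keys r)"
    define j where "j = Min (Poly_Mapping.keys c)"
    have "r \<noteq> 0" "c \<noteq> 0" using Suc by (metis nat.distinct(1) total_eq_0_iff)+
    then have "Poly_Mapping.keys r \<noteq> {}" "Poly_Mapping.keys c \<noteq> {}"
      by (auto simp: in_keys_iff intro!: poly_mapping_eqI)
    then have ij: "i \<in> Poly_Mapping.keys r" "j \<in> Poly_Mapping.keys c"
      unfolding i_def j_def by (auto intro!: Min_in)
    then obtain r' c' where rc: "r = Poly_Mapping.single i 1 + r'" "c = Poly_Mapping.single j 1 + c'"
      by (metis in_keys_decompose)
    have "\<exists>t. staircase m n t \<and> weight t = (r', c')"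
      using Suc.prems Suc.hyps(2) by (intro Suc.hyps(1)) (simp_all add: rc total_add)
    then obtain t where t: "staircase m n t" "weight t = (r', c')" by auto
    \<comment> \<open>The rest of the support is componentwise above the corner, so adding the
      corner keeps it a chain.\<close>
    have "i \<le> fst x" "j \<le> snd x" if "x \<in> Poly_Mapping.keys t" for x
    proof -
      have "fst x \<in> Poly_Mapping.keys (fst (weight t))" "snd x \<in> Poly_Mapping.keys (snd (weight t))"
        using that by (simp_all add: weight_def keys_push)
      then have "fst x \<in> Poly_Mapping.keys r" "snd x \<in> Poly_Mapping.keys c"
        by (simp_all add: t rc)
      then show "i \<le> fst x" "j \<le> snd x" by (simp_all add: i_def j_def)
    qed
    moreover have "i \<in> {1..m}" "j \<in> {1..n}" using ij Suc.prems by auto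
    ultimately have "staircase m n (Poly_Mapping.single (i, j) 1 + t)"
      using t(1) by (force simp: staircase_iff)
    moreover have "weight (Poly_Mapping.single (i, j) 1 + t) = (r, c)"
      by (simp add: weight_add t rc)
    ultimately show ?case by blast
  qed
  then show ?thesis using that by blast
qed

text \<open>The exponent pairs of the basis of the quotient. The monomials \<open>s^r t^c\<close>
  with equal totals span the image of the polynomial ring, the Segre ring; the strict bound on
  \<open>c\<close> discards those that the column powers kill.\<close>

definition segre_weights :: "nat \<Rightarrow> nat \<Rightarrow> nat \<Rightarrow> ((nat \<Rightarrow>\<^sub>0 nat) \<times> (nat \<Rightarrow>\<^sub>0 nat)) set"
  where "segre_weights m n q = {(r, c). total r = total c \<and> Poly_Mapping.keys r \<subseteq> {1..m} \<and>
    Poly_Mapping.keys c \<subseteq> {1..n} \<and> (\<forall>j. Poly_Mapping.lookup c j < q)}"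

text \<open>Because \<open>q\<close> is positive, the bound \<open>q - 1\<close> on column sums is
  the strict bound by \<open>q\<close>, which is also the second alternative in
  \<open>staircase_set\<close>. What remains is injectivity and surjectivity of
  \<open>weight\<close> on staircase monomials.\<close>

lemma bij_betw_weight:
  assumes "q > 0"
  shows "bij_betw weight (staircase_set q m n (\<lambda>_. \<infinity>) (\<lambda>_. enat (q - 1))) (segre_weights m n q)"
proof -
  let ?S = "staircase_set q m n (\<lambda>_. \<infinity>) (\<lambda>_. enat (q - 1))"
  have S: "t \<in> ?S \<longleftrightarrow> staircase m n t \<and> (\<forall>j\<in>{1..n}. Poly_Mapping.lookup (snd (weight t)) j < q)" for t
  proof (cases "staircase m n t")
    case True
    then have "Poly_Mapping.keys t \<subseteq> {1..m} \<times> {1..n}" by (simp add: staircase_def)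
    then show ?thesis using True assms
      by (auto simp: staircase_set_def lookup_snd_weight Suc_le_eq[symmetric] le_diff_conv2
        simp del: One_nat_def)
  qed (simp add: staircase_set_def)
  have "weight t \<in> segre_weights m n q" if "t \<in> ?S" for t
  proof -
    have t: "staircase m n t" "\<forall>j\<in>{1..n}. Poly_Mapping.lookup (snd (weight t)) j < q"
      using that S by auto
    have keys: "Poly_Mapping.keys (fst (weight t)) \<subseteq> {1..m}" "Poly_Mapping.keys (snd (weight t)) \<subseteq> {1..n}"
      using t(1) keys_weight[of t "{1..m}" "{1..n}"] by (simp_all add: staircase_def)
    have "Poly_Mapping.lookup (snd (weight t)) j < q" for j
      using t(2) assms lookup_eq_0_outside[OF keys(2), of j] by (cases "j \<in> {1..n}") auto
    then show ?thesis using keys by (simp add: segre_weights_def split_beta)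
  qed
  moreover have "\<exists>t\<in>?S. weight t = b" if "b \<in> segre_weights m n q" for b
  proof -
    obtain r c where "b = (r, c)" by (cases b)
    with that obtain t where "staircase m n t" "weight t = b"
      using staircase_weight_surj[of r c m n] by (auto simp: segre_weights_def)
    moreover have "\<forall>j. Poly_Mapping.lookup (snd b) j < q"
      using that by (auto simp: segre_weights_def)
    ultimately show ?thesis using S by auto
  qed
  ultimately have "weight ` ?S = segre_weights m n q" by blast
  moreover have "inj_on weight ?S" using S staircase_weight_inj by (intro inj_onI) blast
  ultimately show ?thesis by (simp add: bij_betw_def)
qed

lemma card_segre_weights:
  assumes "m > 0" "n > 0" "q > 0"
  shows "card (segre_weights m n q) = card (bounded_tuples q n (m + n - 1) (n * (q - 1)))"
proof -
  let ?l = Poly_Mapping.lookup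
  \<comment> \<open>The entries are the complements of the \<open>c_j\<close>, then
    \<open>r_1\<close> to \<open>r_(m-1)\<close>; \<open>Suc\<close> passes from list positions,
    which start at 0, to row and column indices, which start at 1. As the totals agree, the entries
    sum to \<open>n * (q - 1) - r_m\<close>, so \<open>r_m\<close> is the slack.\<close>
  define f where "f b = map (\<lambda>j. q - 1 - ?l (snd b) (Suc j)) [0..<n] @ map (\<lambda>i. ?l (fst b) (Suc i)) [0..<m - 1]"
    for b :: "(nat \<Rightarrow>\<^sub>0 nat) \<times> (nat \<Rightarrow>\<^sub>0 nat)"
  have total_eq: "total r = (\<Sum>i<m. ?l r (Suc i))" if "Poly_Mapping.keys r \<subseteq> {1..m}" for r and m :: nat
    using that by (simp add: total_eq_sum[of "{1..m}"] sum.atLeast1_atMost_eq)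
  have sum_f: "sum_list (f (r, c)) + total c = n * (q - 1) + (\<Sum>i<m - 1. ?l r (Suc i))"
    if "\<forall>j. ?l c j < q" "Poly_Mapping.keys c \<subseteq> {1..n}" for r c
  proof -
    have "(\<Sum>j<n. q - 1 - ?l c (Suc j)) + (\<Sum>j<n. ?l c (Suc j)) = (\<Sum>j<n. q - 1)"
      unfolding sum.distrib[symmetric] using that(1) assms(3)
      by (intro sum.cong) (auto simp: Suc_le_eq[symmetric] Suc_diff_le less_eq_Suc_le)
    then show ?thesis
      using total_eq[OF that(2)]
      by (simp add: f_def interv_sum_list_conv_sum_set_nat atLeast0LessThan)
  qed
  have split_m: "(\<Sum>i<m. g i) = (\<Sum>i<m - 1. g i) + g (m - 1)" for g :: "nat \<Rightarrow> nat"
    using assms(1) by (cases m) auto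
  have "bij_betw f (segre_weights m n q) (bounded_tuples q n (m + n - 1) (n * (q - 1)))"
    unfolding bij_betw_def
  proof (intro conjI)
    show "inj_on f (segre_weights m n q)"
    proof (rule inj_onI)
      fix b b' assume b: "b \<in> segre_weights m n q" and b': "b' \<in> segre_weights m n q" and eq: "f b = f b'"
      obtain r c r' c' where bb: "b = (r, c)" "b' = (r', c')" by (cases b, cases b')
      note B = b[unfolded segre_weights_def bb] b'[unfolded segre_weights_def bb]
      have "c = c'"
      proof (rule poly_mapping_eqI)
        fix j
        show "?l c j = ?l c' j"
        proof (cases "j \<in> {1..n}")
          case True
          then obtain j' where j': "j = Suc j'" "j' < n" by (cases j) auto
          then have "q - 1 - ?l c j = q - 1 - ?l c' j"
            using eq by (auto simp: f_def bb)
          moreover have "?l c j < q" "?l c' j < q" using B by auto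
          ultimately show ?thesis by linarith
        next
          case False
          then show ?thesis using B by (simp add: lookup_eq_0_outside[of _ "{1..n}"])
        qed
      qed
      have r_eq: "?l r (Suc i) = ?l r' (Suc i)" if "i < m - 1" for i
        using eq that by (auto simp: f_def bb)
      have "total r = total r'" using B \<open>c = c'\<close> by auto
      \<comment> \<open>The omitted last row exponent is recovered from the total, which
        \<open>c\<close> fixes.\<close>
      then have "?l r (Suc (m - 1)) = ?l r' (Suc (m - 1))"
        using B total_eq[of r m] total_eq[of r' m] r_eq by (simp add: split_m)
      then have r_eq': "?l r (Suc i) = ?l r' (Suc i)" if "i < m" for i
        using r_eq[of i] that by (cases "i = m - 1") auto
      have "r = r'"
      proof (rule poly_mapping_eqI)
        fix i
        show "?l r i = ?l r' i"
        proof (cases "i \<in> {1..m}")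
          case True
          then show ?thesis using r_eq'[of "i - 1"] by auto
        next
          case False
          then show ?thesis using B by (simp add: lookup_eq_0_outside[of _ "{1..m}"])
        qed
      qed
      then show "b = b'" using \<open>c = c'\<close> bb by simp
    qed
    show "f ` segre_weights m n q = bounded_tuples q n (m + n - 1) (n * (q - 1))"
    proof (intro antisym subsetI)
      fix t assume "t \<in> f ` segre_weights m n q"
      then obtain r c where rc: "t = f (r, c)" "(r, c) \<in> segre_weights m n q" by auto
      note B = rc(2)[unfolded segre_weights_def, simplified]
      have "sum_list t + total r = n * (q - 1) + (\<Sum>i<m - 1. ?l r (Suc i))"
        using sum_f[of c r] B by (simp add: rc)
      moreover have "(\<Sum>i<m - 1. ?l r (Suc i)) \<le> total r"
        using B total_eq[of r m] by (simp add: split_m)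
      ultimately have "sum_list t \<le> n * (q - 1)" by linarith
      then show "t \<in> bounded_tuples q n (m + n - 1) (n * (q - 1))"
        using assms by (auto simp: bounded_tuples_def rc f_def nth_append)
    next
      fix t assume "t \<in> bounded_tuples q n (m + n - 1) (n * (q - 1))"
      then have t: "length t = m + n - 1" "sum_list t \<le> n * (q - 1)" "\<And>i. i < n \<Longrightarrow> t ! i < q"
        by (auto simp: bounded_tuples_def)
      \<comment> \<open>The inverse map: \<open>g\<close> complements the first \<open>n\<close>
        entries, and \<open>h\<close> reads off the others and sets the exponent of row
        \<open>m\<close> to the slack.\<close>
      define g where "g j = (if j \<in> {1..n} then q - 1 - t ! (j - 1) else 0)" for j
      define h where "h i = (if i \<in> {1..m - 1} then t ! (n + i - 1)
          else if i = m then n * (q - 1) - sum_list t else 0)" for i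
      have fin: "finite {j. g j \<noteq> 0}" "finite {i. h i \<noteq> 0}"
        by (rule finite_subset[of _ "{..n + m}"]; auto simp: g_def h_def split: if_splits)+
      define c where "c = Abs_poly_mapping g"
      define r where "r = Abs_poly_mapping h"
      have l: "?l c = g" "?l r = h" unfolding c_def r_def by (rule lookup_Abs_poly_mapping, rule fin)+
      have keys: "Poly_Mapping.keys c \<subseteq> {1..n}" "Poly_Mapping.keys r \<subseteq> {1..m}"
        using assms by (auto simp: in_keys_iff l g_def h_def split: if_splits)
      have less: "\<forall>j. ?l c j < q" using assms by (auto simp: l g_def)
      have ft: "f (r, c) = t"
      proof (rule nth_equalityI)
        show "length (f (r, c)) = length t" using assms by (simp add: f_def t)
        fix i assume "i < length (f (r, c))"
        then have i: "i < n + (m - 1)" by (simp add: f_def)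
        show "f (r, c) ! i = t ! i"
        proof (cases "i < n")
          case True
          then show ?thesis using t(3)[of i] by (simp add: f_def nth_append l g_def)
        next
          case False
          then show ?thesis using i by (simp add: f_def nth_append l h_def)
        qed
      qed
      have "total r = (\<Sum>i<m - 1. ?l r (Suc i)) + (n * (q - 1) - sum_list t)"
        using total_eq[OF keys(2)] assms by (simp add: split_m l h_def)
      moreover have "sum_list t + total c = n * (q - 1) + (\<Sum>i<m - 1. ?l r (Suc i))"
        using sum_f[OF less keys(1), of r] by (simp add: ft)
      ultimately have "total r = total c" using t(2) by linarith
      then have "(r, c) \<in> segre_weights m n q" using keys less by (simp add: segre_weights_def)
      then show "t \<in> f ` segre_weights m n q" using ft by force
    qed
  qed
  then show ?thesis by (rule bij_betw_same_card)
qed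

lemma finite_segre_weights: "q > 0 \<Longrightarrow> finite (segre_weights m n q)"
  using bij_betw_finite[OF bij_betw_weight] finite_staircase_set by blast

text \<open>The complement of \<open>segre_weights\<close> absorbs multiplication by monomials, so
  it defines an ideal: removing a factor can only lower exponents, and a factor \<open>t\<close>
  contributes equally to both totals.\<close>

lemma segre_weights_add: "weight t + b \<in> segre_weights m n q \<Longrightarrow> b \<in> segre_weights m n q"
proof -
  assume "weight t + b \<in> segre_weights m n q"
  moreover from this have "Poly_Mapping.lookup (snd b) j < q" for j
    by (auto simp: segre_weights_def split_beta lookup_add intro: le_less_trans[OF le_add2])
  ultimately show ?thesis
    by (simp add: segre_weights_def split_beta total_add)
qed

lemma segre_weights_lift:
  assumes "b \<in> segre_weights m n q"
  obtains t where "Poly_Mapping.keys t \<subseteq> {1..m} \<times> {1..n}" "weight t = b"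
proof -
  obtain r c where "b = (r, c)" by (cases b)
  with assms obtain t where "staircase m n t" "weight t = b"
    using staircase_weight_surj[of r c m n] by (auto simp: segre_weights_def)
  then show ?thesis by (intro that) (simp_all add: staircase_def)
qed

subsection \<open>Ideals of the polynomial ring\<close>

lemma mpoly_ring_simps [simp]:
  "monoid.mult (mpoly_ring V) = (*)" "add (mpoly_ring V) = (+)"
  "one (mpoly_ring V) = 1" "ring.zero (mpoly_ring V) = 0"
  by (simp_all add: mpoly_ring_def)

lemma carrier_mpoly_ring:
  "f \<in> carrier (mpoly_ring V) \<longleftrightarrow> (\<forall>t\<in>Poly_Mapping.keys f. Poly_Mapping.keys t \<subseteq> V)"
  by (simp add: mpoly_ring_def)

lemma single_in_mpoly_ring: "Poly_Mapping.keys t \<subseteq> V \<Longrightarrow> Poly_Mapping.single t c \<in> carrier (mpoly_ring V)"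
  by (simp add: carrier_mpoly_ring)

lemma uminus_in_mpoly_ring: "f \<in> carrier (mpoly_ring V) \<Longrightarrow> - f \<in> carrier (mpoly_ring V)"
  by (simp add: carrier_mpoly_ring in_keys_iff)

lemma mpoly_idealI:
  fixes J :: "('v, 'k::field) mpoly set"
  assumes "J \<subseteq> carrier (mpoly_ring V)" "0 \<in> J"
    and "\<And>f g. f \<in> J \<Longrightarrow> g \<in> J \<Longrightarrow> f + g \<in> J"
    and "\<And>f g. f \<in> carrier (mpoly_ring V) \<Longrightarrow> g \<in> J \<Longrightarrow> f * g \<in> J"
  shows "ideal J (mpoly_ring V)"
proof -
  interpret R: cring "mpoly_ring V :: ('v, 'k) mpoly ring" by (rule cring_mpoly_ring)
  show ?thesis
  proof (rule idealI)
    show "subgroup J (add_monoid (mpoly_ring V))"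
    proof (rule R.add.subgroupI)
      show "\<ominus>\<^bsub>mpoly_ring V\<^esub> f \<in> J" if f: "f \<in> J" for f
      proof -
        have "\<ominus>\<^bsub>mpoly_ring V\<^esub> f = - f"
          using assms(1) f by (intro R.minus_equality) (auto intro: uminus_in_mpoly_ring)
        also have "\<dots> = (- 1) * f" by simp
        also have "\<dots> \<in> J" 
          using R.one_closed f by (intro assms(4) uminus_in_mpoly_ring) auto
        finally show ?thesis .
      qed
    qed (use assms in auto)
    show "f \<otimes>\<^bsub>mpoly_ring V\<^esub> g \<in> J" if "g \<in> J" "f \<in> carrier (mpoly_ring V)" for f g
      using assms(4) that by simp
    show "g \<otimes>\<^bsub>mpoly_ring V\<^esub> f \<in> J" if "g \<in> J" "f \<in> carrier (mpoly_ring V)" for f g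
      using assms(4)[of f g] that by (simp add: mult.commute)
  qed (simp_all add: R.ring_axioms)
qed

lemma mpoly_ideal_closed:
  fixes J :: "('v, 'k::field) mpoly set"
  assumes "ideal J (mpoly_ring V)"
  shows "0 \<in> J" "J \<subseteq> carrier (mpoly_ring V)"
    and "f \<in> J \<Longrightarrow> g \<in> J \<Longrightarrow> f + g \<in> J"
    and "h \<in> carrier (mpoly_ring V) \<Longrightarrow> f \<in> J \<Longrightarrow> h * f \<in> J"
    and "f \<in> J \<Longrightarrow> - f \<in> J"
    and "f \<in> J \<Longrightarrow> g \<in> J \<Longrightarrow> f - g \<in> J"
proof -
  interpret J: ideal J "mpoly_ring V" by fact
  show zero: "0 \<in> J" "J \<subseteq> carrier (mpoly_ring V)"
    using additive_subgroup.zero_closed[OF J.additive_subgroup_axioms] J.a_subset by simp_all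
  show add: "\<And>f g. f \<in> J \<Longrightarrow> g \<in> J \<Longrightarrow> f + g \<in> J"
    using additive_subgroup.a_closed[OF J.additive_subgroup_axioms] by simp
  show mult: "\<And>f h. h \<in> carrier (mpoly_ring V) \<Longrightarrow> f \<in> J \<Longrightarrow> h * f \<in> J"
    using J.I_l_closed by simp
  have neg: "- f \<in> J" if "f \<in> J" for f
    using mult[of "- 1" f] uminus_in_mpoly_ring[of "1 :: ('v, 'k) mpoly" V] J.one_closed that by simp
  then show "f \<in> J \<Longrightarrow> - f \<in> J" .
  show "f \<in> J \<Longrightarrow> g \<in> J \<Longrightarrow> f - g \<in> J"
    using add[of f "- g"] neg by simp
qed

section \<open>Sums and powers of ideals\<close>

lemma (in ring) set_add_ideals_upper:
  assumes "ideal I R" "ideal J R"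
  shows "I \<subseteq> I <+>\<^bsub>R\<^esub> J" "J \<subseteq> I <+>\<^bsub>R\<^esub> J"
proof -
  interpret I: ideal I R by fact
  interpret J: ideal J R by fact
  show "I \<subseteq> I <+>\<^bsub>R\<^esub> J"
  proof
    fix x assume "x \<in> I"
    then have "x \<oplus> \<zero> \<in> I <+>\<^bsub>R\<^esub> J" using J.zero_closed unfolding set_add_def' by blast
    then show "x \<in> I <+>\<^bsub>R\<^esub> J" using \<open>x \<in> I\<close> by (simp add: I.Icarr)
  qed
  show "J \<subseteq> I <+>\<^bsub>R\<^esub> J"
  proof
    fix x assume "x \<in> J"
    then have "\<zero> \<oplus> x \<in> I <+>\<^bsub>R\<^esub> J" using I.zero_closed unfolding set_add_def' by blast
    then show "x \<in> I <+>\<^bsub>R\<^esub> J" using \<open>x \<in> J\<close> by (simp add: J.Icarr)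
  qed
qed

lemma (in ring) set_add_ideals_least:
  assumes "ideal K R" "I \<subseteq> K" "J \<subseteq> K"
  shows "I <+>\<^bsub>R\<^esub> J \<subseteq> K"
proof -
  interpret K: ideal K R by fact
  show ?thesis using assms by (auto simp: set_add_def' subset_iff)
qed

lemma (in cring) finsum_ideals_set:
  assumes "finite A" "\<And>j. j \<in> A \<Longrightarrow> ideal (I j) R"
  shows "ideal (\<Oplus>\<^bsub>ideals_set R\<^esub>j\<in>A. I j) R"
    and "j \<in> A \<Longrightarrow> I j \<subseteq> (\<Oplus>\<^bsub>ideals_set R\<^esub>j\<in>A. I j)"
    and "ideal K R \<Longrightarrow> (\<And>j. j \<in> A \<Longrightarrow> I j \<subseteq> K) \<Longrightarrow> (\<Oplus>\<^bsub>ideals_set R\<^esub>j\<in>A. I j) \<subseteq> K"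
proof -
  interpret S: semiring "ideals_set R" by (rule ideals_set_is_semiring)
  have S: "carrier (ideals_set R) = {I. ideal I R}" "add (ideals_set R) = set_add R"
    "ring.zero (ideals_set R) = {\<zero>}"
    by (simp_all add: ideals_set_def)
  \<comment> \<open>Finite sums are least upper bounds for inclusion. The three claims are proved
    together because the induction step for the bounds uses that the partial sum is an
    ideal.\<close>
  have "ideal (finsum (ideals_set R) I A) R \<and> (\<forall>j\<in>A. I j \<subseteq> finsum (ideals_set R) I A) \<and>
     (\<forall>K. ideal K R \<longrightarrow> (\<forall>j\<in>A. I j \<subseteq> K) \<longrightarrow> finsum (ideals_set R) I A \<subseteq> K)"
    using assms
  proof (induction A rule: finite_induct)
    case empty
    then show ?case
      by (auto simp: S zeroideal additive_subgroup.zero_closed ideal.axioms(1))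
  next
    case (insert a A)
    have eq: "finsum (ideals_set R) I (insert a A) = I a <+>\<^bsub>R\<^esub> finsum (ideals_set R) I A"
      using insert by (subst S.finsum_insert) (auto simp: S)
    have "ideal (finsum (ideals_set R) I A) R" "ideal (I a) R" using insert by auto
    note upper = set_add_ideals_upper[OF this(2,1)] and ideal = add_ideals[OF this(2,1)]
    then show ?case unfolding eq using insert set_add_ideals_least by (auto; blast)
  qed
  then show "ideal (\<Oplus>\<^bsub>ideals_set R\<^esub>j\<in>A. I j) R"
    and "j \<in> A \<Longrightarrow> I j \<subseteq> (\<Oplus>\<^bsub>ideals_set R\<^esub>j\<in>A. I j)"
    and "ideal K R \<Longrightarrow> (\<And>j. j \<in> A \<Longrightarrow> I j \<subseteq> K) \<Longrightarrow> (\<Oplus>\<^bsub>ideals_set R\<^esub>j\<in>A. I j) \<subseteq> K"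
    by auto
qed

lemma (in cring) ideals_set_pow:
  shows "I [^]\<^bsub>ideals_set R\<^esub> (0::nat) = carrier R"
    and "I [^]\<^bsub>ideals_set R\<^esub> Suc k = ideal_prod R (I [^]\<^bsub>ideals_set R\<^esub> k) I"
    and "ideal I R \<Longrightarrow> ideal (I [^]\<^bsub>ideals_set R\<^esub> (k::nat)) R"
proof -
  interpret S: semiring "ideals_set R" by (rule ideals_set_is_semiring)
  show "I [^]\<^bsub>ideals_set R\<^esub> (0::nat) = carrier R"
    and "I [^]\<^bsub>ideals_set R\<^esub> Suc k = ideal_prod R (I [^]\<^bsub>ideals_set R\<^esub> k) I"
    by (simp_all add: ideals_set_def)
  show "ideal I R \<Longrightarrow> ideal (I [^]\<^bsub>ideals_set R\<^esub> (k::nat)) R"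
    using S.nat_pow_closed[of I k] by (simp add: ideals_set_def)
qed

text \<open>The preimage, under the homomorphism \<open>push weight\<close>, of the span of the
  monomials with exponent pairs in \<open>U\<close>. It always contains the kernel.\<close>

definition weight_ideal ::
  "nat \<Rightarrow> nat \<Rightarrow> ((nat \<Rightarrow>\<^sub>0 nat) \<times> (nat \<Rightarrow>\<^sub>0 nat)) set \<Rightarrow> (nat \<times> nat, 'k::field) mpoly set"
  where "weight_ideal m n U = {f \<in> carrier (generic_ring m n). Poly_Mapping.keys (push weight f) \<subseteq> U}"

lemma push_weight_mult: "push weight (f * g) = push weight f * push weight g"
  for f g :: "('a \<times> 'b, 'k::field) mpoly"
  by (rule push_mult) (rule weight_add)

text \<open>Every exponent pair in a product is the weight of a monomial of the first factor plus a
  pair from the second, so closure of \<open>U\<close> under such translations suffices.\<close>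

lemma ideal_weight_ideal:
  assumes "\<And>b t. b \<in> U \<Longrightarrow> Poly_Mapping.keys t \<subseteq> {1..m} \<times> {1..n} \<Longrightarrow> weight t + b \<in> U"
  shows "ideal (weight_ideal m n U :: (nat \<times> nat, 'k::field) mpoly set) (generic_ring m n)"
proof -
  interpret R: cring "generic_ring m n :: (nat \<times> nat, 'k) mpoly ring"
    unfolding generic_ring_def by (rule cring_mpoly_ring)
  show ?thesis
    unfolding generic_ring_def
  proof (rule mpoly_idealI)
    fix f g :: "(nat \<times> nat, 'k) mpoly"
    show "f + g \<in> weight_ideal m n U" if "f \<in> weight_ideal m n U" "g \<in> weight_ideal m n U"
      using that R.a_closed[of f g] Poly_Mapping.keys_add[of "push weight f" "push weight g"]
      by (auto simp: weight_ideal_def push_add generic_ring_def)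
    assume f: "f \<in> carrier (mpoly_ring ({1..m} \<times> {1..n}))" and g: "g \<in> weight_ideal m n U"
    have "Poly_Mapping.keys (push weight (f * g)) \<subseteq> U"
    proof
      fix b assume "b \<in> Poly_Mapping.keys (push weight (f * g))"
      then obtain a c where ac: "b = a + c" "a \<in> Poly_Mapping.keys (push weight f)"
          "c \<in> Poly_Mapping.keys (push weight g)"
        using Poly_Mapping.keys_mult[of "push weight f" "push weight g"]
        unfolding push_weight_mult by blast
      obtain t where "t \<in> Poly_Mapping.keys f" "a = weight t"
        using ac(2) keys_push_subset[of weight f] by blast
      moreover from this have "Poly_Mapping.keys t \<subseteq> {1..m} \<times> {1..n}"
        using f unfolding carrier_mpoly_ring by blast
      moreover have "c \<in> U" using ac(3) g unfolding weight_ideal_def by blast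
      ultimately show "b \<in> U" using ac(1) assms by metis
    qed
    then show "f * g \<in> weight_ideal m n U"
      using R.m_closed[of f g] f g by (auto simp: weight_ideal_def generic_ring_def)
  qed (use R.zero_closed in \<open>auto simp: weight_ideal_def generic_ring_def\<close>)
qed

lemma single_in_weight_ideal:
  "Poly_Mapping.keys t \<subseteq> {1..m} \<times> {1..n} \<Longrightarrow> weight t \<in> U \<Longrightarrow>
    Poly_Mapping.single t c \<in> weight_ideal m n U"
  by (simp add: weight_ideal_def generic_ring_def single_in_mpoly_ring)

lemma Var_mult: "Var x * Var y = Poly_Mapping.single (Poly_Mapping.single x 1 + Poly_Mapping.single y 1) 1"
  by (simp add: Var_def mult_single)

lemma Var_power: "(Var x :: ('v, 'k::field) mpoly) ^ q = Poly_Mapping.single (Poly_Mapping.single x q) 1"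
proof (induction q)
  case (Suc q)
  have "(Var x :: ('v, 'k) mpoly) ^ Suc q = Poly_Mapping.single (Poly_Mapping.single x 1) 1 * Poly_Mapping.single (Poly_Mapping.single x q) 1"
    by (simp only: power_Suc Suc) (simp add: Var_def)
  then show ?case by (simp only: mult_single single_add[symmetric]) simp
qed simp

section \<open>The ideals of the generic matrix in terms of weights\<close>

context
  fixes m n :: nat and R :: "(nat \<times> nat, 'k::field) mpoly ring"
  defines "R \<equiv> generic_ring m n"
begin

interpretation cring R
  unfolding R_def generic_ring_def by (rule cring_mpoly_ring)

lemma R_simps:
  "f \<otimes>\<^bsub>R\<^esub> g = f * g" "f \<oplus>\<^bsub>R\<^esub> g = f + g" "\<one>\<^bsub>R\<^esub> = 1" "\<zero>\<^bsub>R\<^esub> = 0"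
  by (simp_all add: R_def generic_ring_def)

lemma R_ideal_closed:
  assumes "ideal J R"
  shows "0 \<in> J"
    and "f \<in> J \<Longrightarrow> g \<in> J \<Longrightarrow> f + g \<in> J"
    and "h \<in> carrier R \<Longrightarrow> f \<in> J \<Longrightarrow> h * f \<in> J"
    and "f \<in> J \<Longrightarrow> - f \<in> J"
    and "f \<in> J \<Longrightarrow> g \<in> J \<Longrightarrow> f - g \<in> J"
  using mpoly_ideal_closed[OF assms[unfolded R_def generic_ring_def]]
  unfolding R_def generic_ring_def by simp_all

lemma single_in_R: "Poly_Mapping.keys t \<subseteq> {1..m} \<times> {1..n} \<Longrightarrow> Poly_Mapping.single t c \<in> carrier R"
  by (simp add: R_def generic_ring_def single_in_mpoly_ring)

lemma Var_in_R: "x \<in> {1..m} \<times> {1..n} \<Longrightarrow> Var x \<in> carrier R"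
  by (simp add: Var_def single_in_R)

lemma minor_in_R:
  assumes "i \<in> {1..m}" "i' \<in> {1..m}" "j \<in> {1..n}" "j' \<in> {1..n}"
  shows "Var (i, j) * Var (i', j') - Var (i, j') * Var (i', j) \<in> carrier R"
proof -
  have "Var (i, j) * Var (i', j') \<in> carrier R" "Var (i, j') * Var (i', j) \<in> carrier R"
    unfolding Var_mult by (rule single_in_R, use assms in auto)+
  then show ?thesis
    using R_ideal_closed(5)[OF oneideal] by blast
qed

lemma minors_subset: "{Var (i, j) * Var (i', j') - Var (i, j') * Var (i', j) |i i' j j'.
       1 \<le> i \<and> i < i' \<and> i' \<le> m \<and> 1 \<le> j \<and> j < j' \<and> j' \<le> n} \<subseteq> carrier R"
  using minor_in_R by auto

lemma ideal_minors_ideal: "ideal (minors_ideal m n) R"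
  unfolding minors_ideal_def R_def[symmetric] by (rule genideal_ideal[OF minors_subset])

text \<open>The generators have increasing row and column indices; every other choice gives 0 or a
  generator up to sign.\<close>

lemma minor_in_minors_ideal:
  assumes "i \<in> {1..m}" "i' \<in> {1..m}" "j \<in> {1..n}" "j' \<in> {1..n}"
  shows "(Var (i, j) * Var (i', j') - Var (i, j') * Var (i', j) :: (nat \<times> nat, 'k) mpoly) \<in> minors_ideal m n"
proof -
  let ?d = "\<lambda>i i' j j'. Var (i, j) * Var (i', j') - Var (i, j') * Var (i', j) :: (nat \<times> nat, 'k) mpoly"
  note closed = R_ideal_closed[OF ideal_minors_ideal]
  have ordered: "?d i i' j j' \<in> minors_ideal m n"
    if "i \<in> {1..m}" "i' \<in> {1..m}" "j \<in> {1..n}" "j' \<in> {1..n}" "i < i'" "j < j'" for i i' j j'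
    unfolding minors_ideal_def R_def[symmetric]
    by (rule subsetD[OF genideal_self[OF minors_subset]]) (use that in force)
  consider "i = i' \<or> j = j'" | "i < i'" "j < j'" | "i' < i" "j < j'" | "i < i'" "j' < j" | "i' < i" "j' < j"
    by linarith
  then show ?thesis
  proof cases
    case 1
    then have "?d i i' j j' = 0" by (auto simp: mult.commute)
    then show ?thesis using closed(1) by simp
  next
    case 2
    then show ?thesis using ordered assms by simp
  next
    case 3
    then have "- ?d i' i j j' \<in> minors_ideal m n" using assms by (intro closed(4) ordered)
    then show ?thesis by (simp add: mult.commute)
  next
    case 4
    then have "- ?d i i' j' j \<in> minors_ideal m n" using assms by (intro closed(4) ordered)
    then show ?thesis by (simp add: mult.commute)
  next
    case 5
    then have "?d i' i j' j \<in> minors_ideal m n" using ordered assms by simp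
    then show ?thesis by (simp add: mult.commute)
  qed
qed

text \<open>The reason why the kernel is generated by the minors. Fix a variable
  \<open>x_(i,j)\<close> of \<open>t\<close>. Equal row and column sums give \<open>x_(i,j1)\<close>
  and \<open>x_(i1,j)\<close> in \<open>s\<close>; if \<open>s\<close> lacks \<open>x_(i,j)\<close>,
  one minor trades their product for \<open>x_(i,j) * x_(i1,j1)\<close>. Then \<open>x_(i,j)\<close>
  is split off both sides and the degree drops.\<close>

lemma binomial_in_minors_ideal:
  assumes "Poly_Mapping.keys s \<subseteq> {1..m} \<times> {1..n}" "Poly_Mapping.keys t \<subseteq> {1..m} \<times> {1..n}"
    and "weight s = weight t"
  shows "(Poly_Mapping.single s 1 - Poly_Mapping.single t 1 :: (nat \<times> nat, 'k) mpoly) \<in> minors_ideal m n"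
  using assms
proof (induction "total t" arbitrary: s t)
  case 0
  then have "total s = 0" by (metis total_fst_weight)
  then show ?case using 0 R_ideal_closed(1)[OF ideal_minors_ideal] by simp
next
  case (Suc d)
  let ?X = "\<lambda>t. Poly_Mapping.single t 1 :: (nat \<times> nat, 'k) mpoly"
  let ?e = "\<lambda>x. Poly_Mapping.single x 1 :: nat \<times> nat \<Rightarrow>\<^sub>0 nat"
  let ?V = "{1..m} \<times> {1..n}"
  note closed = R_ideal_closed[OF ideal_minors_ideal]
  have "t \<noteq> 0" using Suc by auto
  then obtain i j where ij: "(i, j) \<in> Poly_Mapping.keys t"
    by (metis all_not_in_conv keys_eq_empty surj_pair)
  then obtain t' where t': "t = ?e (i, j) + t'" by (metis in_keys_decompose)
  have "i \<in> fst ` Poly_Mapping.keys s" "j \<in> snd ` Poly_Mapping.keys s"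
    using Suc.prems(3) ij unfolding weight_def keys_push[symmetric]
    by (auto simp: keys_push intro: rev_image_eqI)
  then obtain j1 i1 where ij1: "(i, j1) \<in> Poly_Mapping.keys s" "(i1, j) \<in> Poly_Mapping.keys s"
    by force
  have "\<exists>u. Poly_Mapping.keys (?e (i, j) + u) \<subseteq> ?V \<and> weight s = weight (?e (i, j) + u) \<and>
      ?X s - ?X (?e (i, j) + u) \<in> minors_ideal m n"
  proof (cases "(i, j) \<in> Poly_Mapping.keys s")
    case True
    then obtain u where "s = ?e (i, j) + u" by (metis in_keys_decompose)
    then show ?thesis using Suc.prems(1) closed(1) by (intro exI[of _ u]) simp
  next
    case False
    obtain s' where s': "s = ?e (i, j1) + s'" using ij1(1) by (metis in_keys_decompose)
    \<comment> \<open>The two variables differ, since otherwise both would be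
      \<open>x_(i,j)\<close>, which \<open>s\<close> lacks; so \<open>x_(i1,j)\<close> survives the
      removal of the other.\<close>
    have "(i1, j) \<in> Poly_Mapping.keys s'" using ij1 False by (auto simp: s')
    then obtain v where v: "s' = ?e (i1, j) + v" by (metis in_keys_decompose)
    have V: "i \<in> {1..m}" "i1 \<in> {1..m}" "j \<in> {1..n}" "j1 \<in> {1..n}" "Poly_Mapping.keys v \<subseteq> ?V"
      using Suc.prems(1,2) ij1 ij by (auto simp: s' v)
    have "?X s - ?X (?e (i, j) + (?e (i1, j1) + v)) =
        ?X v * (Var (i, j1) * Var (i1, j) - Var (i, j) * Var (i1, j1))"
      by (simp add: Var_mult mult_single right_diff_distrib s' v ac_simps)
    also have "\<dots> \<in> minors_ideal m n"
      using V by (intro closed(3) minor_in_minors_ideal single_in_R)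
    finally show ?thesis
      using V by (intro exI[of _ "?e (i1, j1) + v"])
        (simp add: s' v weight_add ac_simps plus_prod_def)
  qed
  then obtain u where u: "Poly_Mapping.keys (?e (i, j) + u) \<subseteq> ?V" "weight s = weight (?e (i, j) + u)"
      "?X s - ?X (?e (i, j) + u) \<in> minors_ideal m n" by blast
  have "?X u - ?X t' \<in> minors_ideal m n"
  proof (rule Suc.hyps(1))
    show "d = total t'" using Suc.hyps(2) by (simp add: t' total_add)
    show "weight u = weight t'" using u(2) Suc.prems(3) by (simp add: t' weight_add)
  qed (use u(1) Suc.prems(2) t' in auto)
  moreover have "Var (i, j) \<in> carrier R" using ij Suc.prems(2) by (intro Var_in_R) auto
  ultimately have "Var (i, j) * (?X u - ?X t') \<in> minors_ideal m n" by (intro closed(3))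
  then have "?X (?e (i, j) + u) - ?X t \<in> minors_ideal m n"
    by (simp add: t' Var_def mult_single right_diff_distrib)
  then show ?case using closed(2)[OF u(3)] by fastforce
qed

lemma ideal_var_power_ideal: "ideal (var_power_ideal m n q) R"
  unfolding var_power_ideal_def R_def[symmetric]
  by (rule genideal_ideal) (auto simp: Var_power intro!: single_in_R split: if_splits)

lemma column_vars_subset: "j \<in> {1..n} \<Longrightarrow> {Var (i, j) |i. i \<in> {1..m}} \<subseteq> carrier R"
  using Var_in_R by auto

lemma ideal_column_ideal: "j \<in> {1..n} \<Longrightarrow> ideal (column_ideal m n j) R"
  unfolding column_ideal_def R_def[symmetric] by (rule genideal_ideal[OF column_vars_subset])

text \<open>Each factor from the column ideal contributes at least 1 to the degree in column
  \<open>j\<close>.\<close>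

lemma column_ideal_pow_subset:
  assumes "j \<in> {1..n}"
  shows "column_ideal m n j [^]\<^bsub>ideals_set R\<^esub> k \<subseteq> weight_ideal m n {b. k \<le> Poly_Mapping.lookup (snd b) j}"
proof (induction k)
  case 0
  then show ?case unfolding ideals_set_pow(1) by (simp add: weight_ideal_def R_def)
next
  case (Suc k)
  let ?W = "\<lambda>k. weight_ideal m n {b. k \<le> Poly_Mapping.lookup (snd b) j} :: (nat \<times> nat, 'k) mpoly set"
  have ideal: "ideal (?W k) R" for k
    unfolding R_def by (rule ideal_weight_ideal) (simp add: lookup_add)
  have "{Var (i, j) |i. i \<in> {1..m}} \<subseteq> ?W 1"
    using assms by (auto simp: Var_def weight_def intro!: single_in_weight_ideal)
  then have col: "column_ideal m n j \<subseteq> ?W 1"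
    unfolding column_ideal_def R_def[symmetric] by (rule genideal_minimal[OF ideal])
  show ?case
  proof
    fix f assume "f \<in> column_ideal m n j [^]\<^bsub>ideals_set R\<^esub> Suc k"
    then have "f \<in> ideal_prod R (column_ideal m n j [^]\<^bsub>ideals_set R\<^esub> k) (column_ideal m n j)"
      by (simp only: ideals_set_pow)
    then show "f \<in> ?W (Suc k)"
    proof (induction f rule: ideal_prod.induct)
      case (prod f g)
      then have fg: "f \<in> ?W k" "g \<in> ?W 1" using Suc col by blast+
      have "Poly_Mapping.keys (push weight (f * g)) \<subseteq> {b. Suc k \<le> Poly_Mapping.lookup (snd b) j}"
        using Poly_Mapping.keys_mult[of "push weight f" "push weight g"] fg
        by (fastforce simp: push_weight_mult weight_ideal_def lookup_add)
      then show ?case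
        using m_closed[of f g] fg by (simp add: weight_ideal_def R_simps flip: R_def)
    next
      case (sum f g)
      then show ?case using R_ideal_closed(2)[OF ideal] by (simp add: R_simps)
    qed
  qed
qed

text \<open>The converse for monomials: split off variables of column \<open>j\<close> one after
  another, \<open>k\<close> times.\<close>

lemma single_in_column_ideal_pow:
  assumes "j \<in> {1..n}" "Poly_Mapping.keys t \<subseteq> {1..m} \<times> {1..n}"
    and "k \<le> Poly_Mapping.lookup (snd (weight t)) j"
  shows "Poly_Mapping.single t 1 \<in> column_ideal m n j [^]\<^bsub>ideals_set R\<^esub> k"
  using assms(2,3)
proof (induction k arbitrary: t)
  case 0
  then show ?case unfolding ideals_set_pow(1) by (intro single_in_R)
next
  case (Suc k)
  then have "j \<in> Poly_Mapping.keys (snd (weight t))" by (auto simp: in_keys_iff)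
  then obtain i where ij: "(i, j) \<in> Poly_Mapping.keys t" by (auto simp: weight_def keys_push)
  then obtain u where u: "t = Poly_Mapping.single (i, j) 1 + u" by (metis in_keys_decompose)
  have "k \<le> Poly_Mapping.lookup (snd (weight u)) j"
    using Suc.prems(2) by (simp add: u weight_add lookup_add)
  then have "Poly_Mapping.single u 1 \<in> column_ideal m n j [^]\<^bsub>ideals_set R\<^esub> k"
    using Suc.prems(1) by (intro Suc.IH) (auto simp: u)
  moreover have "i \<in> {1..m}" using Suc.prems(1) ij by auto
  then have "(Var (i, j) :: (nat \<times> nat, 'k) mpoly) \<in> column_ideal m n j"
    unfolding column_ideal_def R_def[symmetric]
    by (intro subsetD[OF genideal_self[OF column_vars_subset[OF assms(1)]]]) auto
  moreover have "Poly_Mapping.single t 1 = Poly_Mapping.single u 1 \<otimes>\<^bsub>R\<^esub> Var (i, j)"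
    by (simp add: R_simps u Var_def mult_single add.commute)
  ultimately show ?case by (simp only: ideals_set_pow(2) ideal_prod.prod)
qed

lemma ideal_segre_weight_ideal: "ideal (weight_ideal m n (- segre_weights m n q)) R"
  unfolding R_def by (rule ideal_weight_ideal) (use segre_weights_add in blast)

lemma ideal_column_power_ideal: "ideal (column_power_ideal m n q) R"
  unfolding column_power_ideal_def R_def[symmetric]
  by (intro finsum_ideals_set(1) ideals_set_pow(3) ideal_column_ideal) simp_all

lemma single_in_column_power_ideal:
  assumes "q > 0" and "Poly_Mapping.keys t \<subseteq> {1..m} \<times> {1..n}" "weight t \<notin> segre_weights m n q"
  shows "(Poly_Mapping.single t 1 :: (nat \<times> nat, 'k) mpoly) \<in> column_power_ideal m n q"
proof -
  have "Poly_Mapping.keys (fst (weight t)) \<subseteq> {1..m}" and keys: "Poly_Mapping.keys (snd (weight t)) \<subseteq> {1..n}"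
    using assms(2) keys_weight[of t "{1..m}" "{1..n}"] by simp_all
  then obtain j where j: "q \<le> Poly_Mapping.lookup (snd (weight t)) j"
    using assms(3) by (auto simp: segre_weights_def split_beta not_less)
  \<comment> \<open>Outside \<open>{1..n}\<close> the exponent is 0, which is less than
    \<open>q\<close>.\<close>
  then have "j \<in> {1..n}" using lookup_eq_0_outside[OF keys, of j] assms(1) by (cases "j \<in> {1..n}") auto
  then have "Poly_Mapping.single t 1 \<in> column_ideal m n j [^]\<^bsub>ideals_set R\<^esub> q"
    using assms(2) j \<open>j \<in> {1..n}\<close> by (intro single_in_column_ideal_pow)
  also have "\<dots> \<subseteq> column_power_ideal m n q"
    unfolding column_power_ideal_def R_def[symmetric]
    by (rule finsum_ideals_set(2))
      (use \<open>j \<in> {1..n}\<close> in \<open>auto intro!: ideals_set_pow(3) ideal_column_ideal\<close>)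
  finally show ?thesis .
qed

text \<open>One inclusion is checked on generators and on powers of column ideals. For the other,
  each monomial of \<open>f\<close> is replaced by a fixed representative of its weight, which
  changes \<open>f\<close> only by an element of the minors ideal; the monomials that remain lie in
  the column powers.\<close>

lemma segre_ideal_eq:
  assumes "q > 0"
  shows
  "minors_ideal m n <+>\<^bsub>R\<^esub> var_power_ideal m n q <+>\<^bsub>R\<^esub> column_power_ideal m n q =
    weight_ideal m n (- segre_weights m n q)"
  (is "?J = ?W")
proof (rule antisym)
  note W = ideal_segre_weight_ideal
  show "?J \<subseteq> ?W"
  proof (intro set_add_ideals_least[OF W])
    show "minors_ideal m n \<subseteq> ?W"
      unfolding minors_ideal_def R_def[symmetric]
    proof (rule genideal_minimal[OF W], clarify)
      fix i i' j j' :: nat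
      assume "1 \<le> i" "i < i'" "i' \<le> m" "1 \<le> j" "j < j'" "j' \<le> n"
      then have "Var (i, j) * Var (i', j') - Var (i, j') * Var (i', j) \<in> carrier R"
        using minor_in_R[of i i' j j'] by simp
      \<comment> \<open>Both products in a minor have the same weight, so the difference is in the
        kernel.\<close>
      moreover have "push weight (Var (i, j) * Var (i', j') - Var (i, j') * Var (i', j) :: (nat \<times> nat, 'k) mpoly) = 0"
        by (simp add: Var_mult push_diff weight_add add.commute)
      ultimately show "Var (i, j) * Var (i', j') - Var (i, j') * Var (i', j) \<in> ?W"
        by (simp add: weight_ideal_def R_def)
    qed
    show "var_power_ideal m n q \<subseteq> ?W"
      unfolding var_power_ideal_def R_def[symmetric]
    proof (rule genideal_minimal[OF W], clarify)
      fix i j :: nat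
      assume "i \<in> {1..m}" "j \<in> {1..n}"
      moreover have "weight (Poly_Mapping.single (i, j) q) \<notin> segre_weights m n q"
        by (auto simp: segre_weights_def intro!: exI[of _ j])
      ultimately show "Var (i, j) ^ q \<in> ?W"
        unfolding Var_power by (intro single_in_weight_ideal) auto
    qed
    have "weight_ideal m n {b. q \<le> Poly_Mapping.lookup (snd b) j} \<subseteq> ?W" for j
      by (auto simp: weight_ideal_def segre_weights_def not_less[symmetric])
    then show "column_power_ideal m n q \<subseteq> ?W"
      unfolding column_power_ideal_def R_def[symmetric]
      using column_ideal_pow_subset[of _ q]
      by (intro finsum_ideals_set(3)[OF _ _ W] ideals_set_pow(3) ideal_column_ideal) blast+
  qed
  have I: "ideal (minors_ideal m n) R" and V: "ideal (var_power_ideal m n q) R"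
    by (rule ideal_minors_ideal, rule ideal_var_power_ideal)
  have J: "ideal ?J R" by (intro add_ideals I V ideal_column_power_ideal)
  have minors: "minors_ideal m n \<subseteq> ?J" and columns: "column_power_ideal m n q \<subseteq> ?J"
    using set_add_ideals_upper[OF I V] set_add_ideals_upper[OF add_ideals[OF I V] ideal_column_power_ideal]
    by blast+
  note closed = R_ideal_closed
  let ?mon = "{t :: nat \<times> nat \<Rightarrow>\<^sub>0 nat. Poly_Mapping.keys t \<subseteq> {1..m} \<times> {1..n}}"
  have const: "Poly_Mapping.single 0 c \<in> carrier R" for c
    by (rule single_in_R) simp
  \<comment> \<open>A section of \<open>weight\<close>; the choice is meaningful for weights of
    monomials in the given variables, the only arguments at which it is used.\<close>
  define \<sigma> where "\<sigma> b = (SOME t. t \<in> ?mon \<and> weight t = b)" for b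
  have \<sigma>: "\<sigma> (weight t) \<in> ?mon" "weight (\<sigma> (weight t)) = weight t" if "t \<in> ?mon" for t
    using someI[of "\<lambda>s. s \<in> ?mon \<and> weight s = weight t" t] that unfolding \<sigma>_def by auto
  have push_in_J: "push \<sigma> g \<in> ?J"
    if "Poly_Mapping.keys g \<subseteq> {weight t |t. t \<in> ?mon \<and> weight t \<notin> segre_weights m n q}" for g
    using that
  proof (induction g rule: poly_mapping_induct_keys)
    case zero
    then show ?case using closed(1)[OF J] by simp
  next
    case (add b c g)
    obtain t where t: "t \<in> ?mon" "weight t = b" "b \<notin> segre_weights m n q" using add(1) by blast
    then have "Poly_Mapping.single (\<sigma> b) 1 \<in> ?J"
      using \<sigma>[OF t(1)] by (intro subsetD[OF columns] single_in_column_power_ideal assms) auto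
    then have "Poly_Mapping.single 0 c * Poly_Mapping.single (\<sigma> b) 1 \<in> ?J"
      by (intro closed(3)[OF J] const)
    then have "Poly_Mapping.single (\<sigma> b) c \<in> ?J"
      by (simp add: mult_single)
    from closed(2)[OF J this add(3)] show ?case
      by (simp add: push_add)
  qed
  show "?W \<subseteq> ?J"
  proof
    fix f assume f: "f \<in> ?W"
    then have keys: "Poly_Mapping.keys f \<subseteq> ?mon"
      by (auto simp: weight_ideal_def generic_ring_def carrier_mpoly_ring)
    \<comment> \<open>By linearity this is a combination of binomials
      \<open>t - \<sigma> (weight t)\<close>.\<close>
    then have "f - push \<sigma> (push weight f) \<in> minors_ideal m n"
    proof (induction f rule: poly_mapping_induct_keys)
      case zero
      then show ?case using closed(1)[OF I] by simp
    next
      case (add t c g)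
      have "(Poly_Mapping.single t 1 - Poly_Mapping.single (\<sigma> (weight t)) 1 :: (nat \<times> nat, 'k) mpoly)
          \<in> minors_ideal m n"
        using add(1) \<sigma>[OF add(1)] by (intro binomial_in_minors_ideal) auto
      then have "Poly_Mapping.single 0 c * (Poly_Mapping.single t 1 - Poly_Mapping.single (\<sigma> (weight t)) 1)
          \<in> minors_ideal m n"
        by (intro closed(3)[OF I] const)
      then have "Poly_Mapping.single t c - Poly_Mapping.single (\<sigma> (weight t)) c \<in> minors_ideal m n"
        by (simp add: right_diff_distrib mult_single)
      from closed(2)[OF I this add(3)] show ?case
        by (simp add: push_add algebra_simps)
    qed
    moreover have "Poly_Mapping.keys (push weight f) \<subseteq> {weight t |t. t \<in> ?mon \<and> weight t \<notin> segre_weights m n q}"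
      using f keys keys_push_subset[of weight f] unfolding weight_ideal_def by blast
    then have "push \<sigma> (push weight f) \<in> ?J"
      by (rule push_in_J)
    ultimately have "(f - push \<sigma> (push weight f)) + push \<sigma> (push weight f) \<in> ?J"
      using minors by (intro closed(2)[OF J]) blast+
    then show "f \<in> ?J" by simp
  qed
qed

end

subsection \<open>Chains of ideals\<close>

text \<open>Each strict inclusion provides a vector outside the span of those chosen before, so
  \<open>V i\<close> contains \<open>i\<close> independent vectors.\<close>

lemma (in vector_space) subspace_chain_length:
  assumes "\<And>i. i \<le> l \<Longrightarrow> subspace (V i)" "\<And>i. i < l \<Longrightarrow> V i \<subset> V (Suc i)"
    and "V l \<subseteq> span T" "finite T"
  shows "l \<le> card T"
proof -
  have "\<exists>S\<subseteq>V i. finite S \<and> independent S \<and> card S = i" if "i \<le> l" for i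
    using that
  proof (induction i)
    case 0
    then show ?case by (intro exI[of _ "{}"]) (simp add: independent_empty)
  next
    case (Suc i)
    then obtain S where S: "S \<subseteq> V i" "finite S" "independent S" "card S = i" by auto
    obtain v where v: "v \<in> V (Suc i)" "v \<notin> V i" using assms(2)[of i] Suc.prems by auto
    have "span S \<subseteq> V i" using S assms(1)[of i] Suc.prems by (intro span_minimal) auto
    then have "v \<notin> span S" "v \<notin> S" using v S by auto
    moreover from this(1) have "independent (insert v S)"
      using S(3) by (rule independent_insertI)
    ultimately show ?case
      using S v assms(2)[of i] Suc.prems by (intro exI[of _ "insert v S"]) auto
  qed
  then obtain S where "S \<subseteq> V l" "independent S" "card S = l" by blast
  then show ?thesis using independent_span_bound[of T S] assms(3,4) by auto
qed

text \<open>\<open>\<Phi>\<close> keeps the coefficients of \<open>push weight f\<close> at the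
  weights in \<open>B\<close>. On the polynomial ring its kernel is
  \<open>weight_ideal m n (- B)\<close>, which every ideal of the chain contains, so the images form
  a strict chain of subspaces of a space spanned by \<open>card B\<close> vectors.\<close>

lemma ideal_chain_upper_bound:
  fixes K :: "nat \<Rightarrow> (nat \<times> nat, 'k::field) mpoly set"
  assumes "finite B" "\<And>i. i \<le> l \<Longrightarrow> ideal (K i) (generic_ring m n)"
    and "weight_ideal m n (- B) \<subseteq> K 0" "\<And>i. i < l \<Longrightarrow> K i \<subset> K (Suc i)"
  shows "l \<le> card B"
proof -
  define \<Phi> :: "(nat \<times> nat, 'k) mpoly \<Rightarrow> _" where
    "\<Phi> f = (\<Sum>b\<in>B. Poly_Mapping.single b (Poly_Mapping.lookup (push weight f) b))" for f
  \<comment> \<open>Scalars act as constant polynomials, so that closure of an ideal under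
    multiplication yields closure of its image under scalars.\<close>
  interpret V: vector_space
    "\<lambda>(c :: 'k) (v :: ((nat \<Rightarrow>\<^sub>0 nat) \<times> (nat \<Rightarrow>\<^sub>0 nat)) \<Rightarrow>\<^sub>0 'k). Poly_Mapping.single 0 c * v"
    by unfold_locales (simp_all add: distrib_left distrib_right single_add mult_single flip: mult.assoc)
  note closed = mpoly_ideal_closed[of _ "{1..m} \<times> {1..n}", folded generic_ring_def, OF assms(2)]
  have \<Phi>_add: "\<Phi> (f + g) = \<Phi> f + \<Phi> g" for f g
    by (simp add: \<Phi>_def push_add lookup_add single_add sum.distrib)
  have \<Phi>_scale: "\<Phi> (Poly_Mapping.single 0 c * f) = Poly_Mapping.single 0 c * \<Phi> f" for c f
  proof -
    have "Poly_Mapping.lookup (Poly_Mapping.single 0 c * g) b = c * Poly_Mapping.lookup g b"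
      for g :: "((nat \<Rightarrow>\<^sub>0 nat) \<times> (nat \<Rightarrow>\<^sub>0 nat)) \<Rightarrow>\<^sub>0 'k" and b
      by (simp add: map.rep_eq when_def flip: mult_map_scale_conv_mult)
    then show ?thesis
      by (simp add: \<Phi>_def push_weight_mult sum_distrib_left mult_single)
  qed
  have \<Phi>_zero: "\<Phi> 0 = 0" by (simp add: \<Phi>_def)
  have lookup_\<Phi>: "Poly_Mapping.lookup (\<Phi> f) b = Poly_Mapping.lookup (push weight f) b" if "b \<in> B" for f b
    using that assms(1) by (simp add: \<Phi>_def lookup_sum lookup_single when_def)
  let ?T = "(\<lambda>b. Poly_Mapping.single b (1 :: 'k)) ` B"
  have "l \<le> card ?T"
  proof (rule V.subspace_chain_length[where V = "\<lambda>i. \<Phi> ` K i"])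
    show "V.subspace (\<Phi> ` K i)" if "i \<le> l" for i
    proof (rule V.subspaceI)
      show "0 \<in> \<Phi> ` K i" using closed(1)[OF that] \<Phi>_zero by (metis imageI)
      show "x + y \<in> \<Phi> ` K i" if "x \<in> \<Phi> ` K i" "y \<in> \<Phi> ` K i" for x y
        using that closed(3)[OF \<open>i \<le> l\<close>] by (auto simp flip: \<Phi>_add)
      have "Poly_Mapping.single 0 c \<in> carrier (generic_ring m n)" for c :: 'k
        by (simp add: generic_ring_def single_in_mpoly_ring)
      then show "Poly_Mapping.single 0 c * x \<in> \<Phi> ` K i" if "x \<in> \<Phi> ` K i" for c x
        using that closed(4)[OF \<open>i \<le> l\<close>] by (auto simp flip: \<Phi>_scale)
    qed
    show "\<Phi> ` K i \<subset> \<Phi> ` K (Suc i)" if i: "i < l" for i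
    proof -
      have J: "weight_ideal m n (- B) \<subseteq> K i"
        using i
      proof (induction i)
        case (Suc i)
        then show ?case using assms(4)[of i] by auto
      qed (rule assms(3))
      obtain f where f: "f \<in> K (Suc i)" "f \<notin> K i" using assms(4)[OF i] by blast
      have "\<Phi> f \<notin> \<Phi> ` K i"
      proof
        assume "\<Phi> f \<in> \<Phi> ` K i"
        then obtain g where g: "g \<in> K i" "\<Phi> f = \<Phi> g" by blast
        then have "f - g \<in> K (Suc i)" using assms(4)[OF i] f i by (intro closed(6)) auto
        then have "f - g \<in> carrier (generic_ring m n)" using closed(2)[of "Suc i"] i by auto
        moreover have "Poly_Mapping.lookup (push weight (f - g)) b = 0" if "b \<in> B" for b
          using lookup_\<Phi>[OF that, of f] lookup_\<Phi>[OF that, of g] g(2) by (simp add: push_diff lookup_minus)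
        ultimately have "f - g \<in> K i"
          using J by (auto simp: weight_ideal_def in_keys_iff)
        then have "(f - g) + g \<in> K i" using g(1) i by (intro closed(3)) auto
        then show False using f(2) by simp
      qed
      then show ?thesis using assms(4)[OF i] f(1) by blast
    qed
    show "\<Phi> ` K l \<subseteq> V.span ?T"
    proof clarify
      fix f
      have "Poly_Mapping.single b c = Poly_Mapping.single 0 c * Poly_Mapping.single b 1"
        for c :: 'k and b :: "(nat \<Rightarrow>\<^sub>0 nat) \<times> (nat \<Rightarrow>\<^sub>0 nat)"
        by (simp add: mult_single)
      then show "\<Phi> f \<in> V.span ?T"
        unfolding \<Phi>_def by (metis (no_types, lifting) V.span_sum V.span_scale V.span_base imageI)
    qed
  qed (use assms(1) in simp)
  also have "\<dots> \<le> card B" using assms(1) by (rule card_image_le)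
  finally show ?thesis .
qed

text \<open>Multiplication by a monomial of positive degree raises the degree of a weight, so adjoining the
  weights one by one, in order of decreasing degree, gives a chain of ideals.\<close>

lemma ideal_chain_of_card:
  assumes "q > 0"
  obtains K :: "nat \<Rightarrow> (nat \<times> nat, 'k::field) mpoly set"
  where "\<And>i. ideal (K i) (generic_ring m n)"
    and "\<And>i. weight_ideal m n (- segre_weights m n q) \<subseteq> K i"
    and "\<And>i. i < card (segre_weights m n q) \<Longrightarrow> K i \<subset> K (Suc i)"
proof -
  let ?B = "segre_weights m n q"
  \<comment> \<open>Negated, so that ascending sorting lists the weights by decreasing
    degree.\<close>
  let ?deg = "\<lambda>b. - int (total (fst b))"
  obtain ys where "set ys = ?B" "distinct ys"
    using finite_distinct_list[OF finite_segre_weights[OF assms, of m n]] by auto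
  then obtain xs where xs: "set xs = ?B" "distinct xs" "sorted (map ?deg xs)"
    using that[of "sort_key ?deg ys"] by simp
  then have len: "length xs = card ?B" by (metis distinct_card)
  \<comment> \<open>All pairs outside \<open>?B\<close> together with the first \<open>i\<close>
    pairs of the list.\<close>
  define U where "U i = {b. b \<in> ?B \<longrightarrow> b \<in> set (take i xs)}" for i
  define K :: "nat \<Rightarrow> (nat \<times> nat, 'k) mpoly set" where "K i = weight_ideal m n (U i)" for i
  have closed: "weight t + b \<in> U i" if b: "b \<in> U i" for t :: "nat \<times> nat \<Rightarrow>\<^sub>0 nat" and b i
  proof (cases "t = 0 \<or> weight t + b \<notin> ?B")
    case True
    then show ?thesis using b by (auto simp: U_def)
  next
    case False
    then have "b \<in> set (take i xs)" using b segre_weights_add[of t b m n q] by (simp add: U_def)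
    then obtain k where k: "k < i" "k < length xs" "xs ! k = b" by (auto simp: in_set_conv_nth)
    obtain k' where k': "k' < length xs" "xs ! k' = weight t + b"
      using False xs(1) by (metis in_set_conv_nth)
    \<comment> \<open>Multiplication by \<open>t\<close> strictly raises the degree, so the
      product's weight comes earlier in the list and is already in \<open>U i\<close>.\<close>
    have "total t > 0" using False by (metis gr0I total_eq_0_iff)
    then have "?deg (xs ! k') < ?deg (xs ! k)" by (simp add: k k' total_add)
    then have "k' < k"
      using sorted_nth_mono[OF xs(3), of k k'] k'(1) k(2) by (cases "k \<le> k'") auto
    then show ?thesis
      using k k' by (auto simp: U_def in_set_conv_nth intro!: exI[of _ k'])
  qed
  show ?thesis
  proof
    show "ideal (K i) (generic_ring m n)" for i
      unfolding K_def by (rule ideal_weight_ideal) (rule closed)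
    show "weight_ideal m n (- ?B) \<subseteq> K i" for i
      by (auto simp: K_def weight_ideal_def U_def)
    show "K i \<subset> K (Suc i)" if i: "i < card ?B" for i
    proof -
      have "U i \<subseteq> U (Suc i)"
        using set_take_subset_set_take[of i "Suc i" xs] by (auto simp: U_def)
      then have "K i \<subseteq> K (Suc i)" by (auto simp: K_def weight_ideal_def)
      moreover have "xs ! i \<in> ?B" using i len xs(1) by (metis nth_mem)
      then obtain t where t: "Poly_Mapping.keys t \<subseteq> {1..m} \<times> {1..n}" "weight t = xs ! i"
        by (rule segre_weights_lift)
      have "xs ! i \<notin> set (take i xs)"
        using xs(2) i len by (auto simp: in_set_conv_nth nth_eq_iff_index_eq)
      then have "xs ! i \<notin> U i" using \<open>xs ! i \<in> ?B\<close> by (simp add: U_def)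
      then have "Poly_Mapping.single t 1 \<notin> K i" by (simp add: K_def weight_ideal_def t)
      moreover have "xs ! i \<in> U (Suc i)" using i len by (simp add: U_def take_Suc_conv_app_nth)
      then have "Poly_Mapping.single t 1 \<in> K (Suc i)"
        unfolding K_def using t by (intro single_in_weight_ideal) auto
      ultimately show ?thesis by blast
    qed
  qed
qed

theorem theorem3p1:
  fixes m n q :: nat
    and R :: "(nat \<times> nat, 'k::field) mpoly ring"
  assumes "m > 0" and "n > 0" and "q > 0"
    and "R = generic_ring m n"
  shows "module_length R
           (quot_module R
             (minors_ideal m n <+>\<^bsub>R\<^esub> var_power_ideal m n q <+>\<^bsub>R\<^esub> column_power_ideal m n q))
         = enat (staircase_number q m n (\<lambda>_. \<infinity>) (\<lambda>_. enat (q - 1)))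
       \<and> int (staircase_number q m n (\<lambda>_. \<infinity>) (\<lambda>_. enat (q - 1))) =
         (\<Sum>i=1..n. (-1) ^ (n - i) * int (n choose i) * int ((i * q + m - 1) choose (m + n - 1)))
       \<and> staircase_number q m n (\<lambda>_. \<infinity>) (\<lambda>_. enat (q - 1)) =
         card {t :: nat list. length t = m + n - 1 \<and> sum_list t \<le> n * (q - 1) \<and>
                 (\<forall>i<n. t ! i < q)}"
proof -
  let ?B = "segre_weights m n q"
  let ?W = "weight_ideal m n (- ?B) :: (nat \<times> nat, 'k) mpoly set"
  have number: "staircase_number q m n (\<lambda>_. \<infinity>) (\<lambda>_. enat (q - 1)) = card ?B"
    unfolding staircase_number_def using bij_betw_weight[OF assms(3)] by (rule bij_betw_same_card)
  have cring: "cring R"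
    unfolding assms(4) generic_ring_def by (rule cring_mpoly_ring)
  have W: "ideal ?W R"
    unfolding assms(4) by (rule ideal_segre_weight_ideal)
  \<comment> \<open>Linear algebra bounds every chain by \<open>card ?B\<close>, and adjoining the
    weights one at a time attains the bound.\<close>
  have "module_length R (quot_module R ?W) = enat (card ?B)"
    unfolding module_length_quot_module[OF cring W]
  proof (rule antisym)
    show "Sup {enat l |l. \<exists>K. (\<forall>i\<le>l. ideal (K i) R \<and> ?W \<subseteq> K i) \<and> (\<forall>i<l. K i \<subset> K (Suc i))}
        \<le> enat (card ?B)"
    proof (rule Sup_least, clarify)
      fix l :: nat and K :: "nat \<Rightarrow> (nat \<times> nat, 'k) mpoly set"
      assume "\<forall>i\<le>l. ideal (K i) R \<and> ?W \<subseteq> K i" "\<forall>i<l. K i \<subset> K (Suc i)"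
      then have "l \<le> card ?B"
        using finite_segre_weights[OF assms(3)] assms(4)
        by (intro ideal_chain_upper_bound[of ?B l K m n]) auto
      then show "enat l \<le> enat (card ?B)" by simp
    qed
    obtain K :: "nat \<Rightarrow> (nat \<times> nat, 'k) mpoly set" where
      "\<And>i. ideal (K i) R" "\<And>i. ?W \<subseteq> K i" "\<And>i. i < card ?B \<Longrightarrow> K i \<subset> K (Suc i)"
      unfolding assms(4) using ideal_chain_of_card[OF assms(3)] by blast
    then show "enat (card ?B) \<le>
        Sup {enat l |l. \<exists>K. (\<forall>i\<le>l. ideal (K i) R \<and> ?W \<subseteq> K i) \<and> (\<forall>i<l. K i \<subset> K (Suc i))}"
      by (intro Sup_upper) blast
  qed
  moreover have "minors_ideal m n <+>\<^bsub>R\<^esub> var_power_ideal m n q <+>\<^bsub>R\<^esub> column_power_ideal m n q = ?W"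
    unfolding assms(4) by (rule segre_ideal_eq[OF assms(3)])
  ultimately show ?thesis
    using card_bounded_tuples_formula[OF assms(1-3)]
    unfolding number card_segre_weights[OF assms(1-3)] by (simp add: bounded_tuples_def)
qed

end
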